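(* Let $k\ge 1$, $\tau\in(0,1/2]$, and let $\{\mathbf p_z\}_{z\in\{-1,1\}^k}$ be a family of probability distributions on a measurable space $\mathcal X$ satisfying the following "densities exist" assumption: for every $z\in\{-1,1\}^k$ and $i\in[k]$, $\mathbf p_{z^{\oplus i}}\ll\mathbf p_z$, and there exist real numbers $\alpha_{z,i}$ with $|\alpha_{z,i}|\le\alpha$ (for a constant $\alpha$ not depending on $z,i$) and measurable functions $\phi_{z,i}\colon\mathcal X\to\mathbb R$ such that $$\frac{d\mathbf p_{z^{\oplus i}}}{d\mathbf p_z}=1+\alpha_{z,i}\phi_{z,i}.$$ Let $\Pi$ be a sequentially interactive protocol using $(\mathcal W_1,\dots,\mathcal W_n)$, let $Z$ be a random variable on $\{-1,1\}^k$ with distribution $\mathrm{Rad}(\tau)^{\otimes k}$, and let $(Y^n,U)$ be the transcript of $\Pi$ when the inputs $X_1,\dots,X_n$ are i.i.d. with common distribution $\mathbf p_Z$. Then $$\Big(\frac1k\sum_{i=1}^k d_{\mathrm{TV}}\big(\mathbf p^{Y^n}_{+i},\mathbf p^{Y^n}_{-i}\big)\Big)^2\le\frac{7}{k}\alpha^2\sum_{t=1}^n\max_{z\in\{-1,1\}^k}\max_{W\in\mathcal W_t}\sum_{i=1}^k\int_{\mathcal Y}\frac{\mathbb E_{\mathbf p_z}[\phi_{z,i}(X)W(y\mid X)]^2}{\mathbb E_{\mathbf p_z}[W(y\mid X)]}\,d\mu(y),$$ where $\mathbf p^{Y^n}_{+i}\,=\,\mathbb E[\mathbf p^{Y^n}_Z\mid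 Z_i=+1]$ and $\mathbf p^{Y^n}_{-i}\,=\,\mathbb E[\mathbf p^{Y^n}_Z\mid Z_i=-1]$.
   Context: A channel from a measurable space $\mathcal X$ to a measure space $(\mathcal Y,\mu)$ is a Markov kernel absolutely continuous w.r.t. $\mu$; $W(y\mid x)$ denotes its density w.r.t. $\mu$ (for finite $\mathcal Y$, $\mu$ is counting measure). For sets $\mathcal W_1,\dots,\mathcal W_n$ of channels from $\mathcal X$ to $\mathcal Y$, a sequentially interactive protocol using $(\mathcal W_1,\dots,\mathcal W_n)$ consists of mutually independent random variables $U,U_1,\dots,U_n$ (independent of the inputs $X_1,\dots,X_n$) and, for each round $t\in[n]$, a choice of channel depending on $(U,U_t)$; player $t$, holding $X_t$, outputs the message $Y_t$ drawn from $W_t(\cdot\mid X_t,Y_1,\dots,Y_{t-1})$, where for every fixed value $y^{t-1}$ of the previous messages the kernel $x\mapsto W_t(\cdot\mid x,y^{t-1})$ is a channel belonging to $\mathcal W_t$. The transcript is $(Y^n,U)$ with $Y^n=(Y_1,\dots,Y_n)$. For $z\in\{-1,1\}^k$, $\mathbf p^{Y^n}_z$ denotes the distribution of $Y^n$ when $X_1,\dots,X_n$ are i.i.d. $\mathbf p_z$; $z^{\oplus i}$ is $z$ with the sign of its $i$th coordinate flipped. $\mathrm{Rad}(\tau)^{\otimes k}$ is the distribution on $\{-1,1\}^k$ with independent coordinates, each equal to $1$ with probability $\tau$. $d_{\mathrm{TV}}$ is the total variation distance.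
   Formalization: The measure μ is assumed σ-finite and channel densities W(y|x) jointly measurable in (x,y); otherwise the claim fails (μ counting measure on [0,1], W the identity channel, atomless p_z: the right side is 0) or the inner expectations may be undefined. *)

theory Defs
  imports "HOL-Probability.Probability"
begin

definition transition_density ::
    "'a measure \<Rightarrow> 'b measure \<Rightarrow> ('a \<Rightarrow> 'b measure) \<Rightarrow> ('a \<Rightarrow> 'b \<Rightarrow> real) \<Rightarrow> bool" where
  "transition_density M \<mu> K w \<longleftrightarrow>
     (\<lambda>(x, y). w x y) \<in> borel_measurable (M \<Otimes>\<^sub>M \<mu>) \<and>
     (\<forall>x\<in>space M. (\<forall>y\<in>space \<mu>. 0 \<le> w x y) \<and> K x = density \<mu> (\<lambda>y. ennreal (w x y)))"

text \<open>
  The density is required to be jointly measurable, so that \<open>x \<mapsto> W(y | x)\<close> can be integrated for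
  fixed \<open>y\<close>. For countable discrete output spaces this holds automatically, see
  \<open>channels_count_space\<close>.
\<close>

definition channels :: "'a measure \<Rightarrow> 'b measure \<Rightarrow> ('a \<Rightarrow> 'b measure) set" where
  "channels M \<mu> =
     {K \<in> M \<rightarrow>\<^sub>M prob_algebra \<mu>.
        (\<forall>x\<in>space M. absolutely_continuous \<mu> (K x)) \<and> (\<exists>w. transition_density M \<mu> K w)}"

text \<open>
  A version of \<open>W(y | x)\<close>. By \<open>information_integral_unique\<close> below the choice of the version
  is immaterial.
\<close>

definition channel_density ::
    "'a measure \<Rightarrow> 'b measure \<Rightarrow> ('a \<Rightarrow> 'b measure) \<Rightarrow> 'a \<Rightarrow> 'b \<Rightarrow> real" where
  "channel_density M \<mu> K = (SOME w. transition_density M \<mu> K w)"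

lemma channel_density:
  assumes "K \<in> channels M \<mu>"
  shows "transition_density M \<mu> K (channel_density M \<mu> K)"
  using assms unfolding channels_def channel_density_def by (metis (mono_tags, lifting) mem_Collect_eq someI_ex)

lemma channels_count_space:
  assumes "countable B"
  shows "channels M (count_space B) = M \<rightarrow>\<^sub>M prob_algebra (count_space B)"
proof (intro equalityI subsetI)
  fix K assume K: "K \<in> M \<rightarrow>\<^sub>M prob_algebra (count_space B)"
  have sets_K: "sets (K x) = Pow B" and space_K: "space (K x) = B" and prob_K: "prob_space (K x)"
    if "x \<in> space M" for x
    using measurable_space[OF K that] sets_eq_imp_space_eq[of "K x" "count_space B"]
    by (auto simp: space_prob_algebra)
  define w where "w x y = measure (K x) {y}" for x y
  have "transition_density M (count_space B) K w"
    unfolding transition_density_def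
  proof (intro conjI ballI)
    have "(\<lambda>x. w x y) \<in> borel_measurable M" if "y \<in> B" for y
      unfolding w_def
      by (rule measurable_compose[OF measurable_prob_algebraD[OF K]])
         (use that in \<open>auto intro!: measurable_measure_subprob_algebra\<close>)
    then have "(\<lambda>q. w (snd q) (fst q)) \<in> borel_measurable (count_space B \<Otimes>\<^sub>M M)"
      using assms by (intro measurable_pair_measure_countable1) auto
    then have "(\<lambda>q. w (snd (prod.swap q)) (fst (prod.swap q))) \<in> borel_measurable (M \<Otimes>\<^sub>M count_space B)"
      by (rule measurable_compose[rotated])
         (simp add: prod.swap_def[abs_def])
    then show "(\<lambda>(x, y). w x y) \<in> borel_measurable (M \<Otimes>\<^sub>M count_space B)"
      by (simp add: case_prod_beta')
  next
    fix x assume x: "x \<in> space M"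
    interpret prob_space "K x" using prob_K[OF x] .
    show "K x = density (count_space B) (\<lambda>y. ennreal (w x y))"
    proof (rule measure_eqI_countable[of _ B])
      fix a assume "a \<in> B"
      then show "emeasure (K x) {a} = emeasure (density (count_space B) (\<lambda>y. ennreal (w x y))) {a}"
        by (subst emeasure_density)
           (auto simp: w_def emeasure_eq_measure nn_integral_count_space_indicator nn_integral_cmult_indicator
              one_ennreal_def[symmetric] intro!: trans[OF _ nn_integral_cmult_indicator[symmetric]])
    qed (use sets_K[OF x] assms in auto)
  qed (auto simp: w_def)
  moreover have "absolutely_continuous (count_space B) (K x)" if "x \<in> space M" for x
    using sets_K[OF that] by (auto simp: absolutely_continuous_def null_sets_def emeasure_count_space
        split: if_splits)
  ultimately show "K \<in> channels M (count_space B)"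
    using K by (auto simp: channels_def)
qed (auto simp: channels_def)

lemma information_integral_unique:
  assumes "sigma_finite_measure \<mu>" and "prob_space p" and "sets p = sets M"
    and "transition_density M \<mu> K v" and "transition_density M \<mu> K w"
    and phi: "\<phi> \<in> borel_measurable M"
  shows "(\<integral>\<^sup>+ y. ennreal ((\<integral>x. \<phi> x * v x y \<partial>p)\<^sup>2 / (\<integral>x. v x y \<partial>p)) \<partial>\<mu>) =
         (\<integral>\<^sup>+ y. ennreal ((\<integral>x. \<phi> x * w x y \<partial>p)\<^sup>2 / (\<integral>x. w x y \<partial>p)) \<partial>\<mu>)"
proof -
  interpret mu: sigma_finite_measure \<mu> by fact
  interpret p: prob_space p by fact
  interpret pair_sigma_finite p \<mu> ..
  note [measurable_cong] = \<open>sets p = sets M\<close>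
  have space_p: "space p = space M" using assms(3) by (rule sets_eq_imp_space_eq)
  have [measurable]: "(\<lambda>(x, y). v x y) \<in> borel_measurable (M \<Otimes>\<^sub>M \<mu>)"
      "(\<lambda>(x, y). w x y) \<in> borel_measurable (M \<Otimes>\<^sub>M \<mu>)" "\<phi> \<in> borel_measurable M"
    using assms by (auto simp: transition_density_def)
  have [measurable]: "v x \<in> borel_measurable \<mu>" "w x \<in> borel_measurable \<mu>" if "x \<in> space M" for x
    using that by measurable
  have eq: "AE y in \<mu>. v x y = w x y" if x: "x \<in> space p" for x
  proof -
    have xM: "x \<in> space M" using x space_p by simp
    have "density \<mu> (\<lambda>y. ennreal (v x y)) = density \<mu> (\<lambda>y. ennreal (w x y))"
      using assms(4,5) xM by (simp add: transition_density_def)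
    then have "AE y in \<mu>. ennreal (v x y) = ennreal (w x y)"
      using mu.density_unique_iff[of "\<lambda>y. ennreal (v x y)" "\<lambda>y. ennreal (w x y)"] xM by simp
    then show ?thesis
      by (rule AE_mp) (use assms(4,5) xM in \<open>auto intro!: AE_I2 simp: transition_density_def\<close>)
  qed
  have "AE x in p. AE y in \<mu>. v x y = w x y"
    using eq by (auto intro: AE_I2)
  then have "AE y in \<mu>. AE x in p. v x y = w x y"
    by (subst (asm) AE_commute) auto
  then show ?thesis
  proof (intro nn_integral_cong_AE, elim AE_mp, intro AE_I2 impI)
    fix y assume y: "y \<in> space \<mu>" and ae: "AE x in p. v x y = w x y"
    have [measurable]: "(\<lambda>x. v x y) \<in> borel_measurable p" "(\<lambda>x. w x y) \<in> borel_measurable p"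
      using y by measurable
    have "(\<integral>x. v x y \<partial>p) = (\<integral>x. w x y \<partial>p)"
      by (rule integral_cong_AE) (use ae in auto)
    moreover have "(\<integral>x. \<phi> x * v x y \<partial>p) = (\<integral>x. \<phi> x * w x y \<partial>p)"
      by (rule integral_cong_AE) (use ae in auto)
    ultimately show "ennreal ((\<integral>x. \<phi> x * v x y \<partial>p)\<^sup>2 / (\<integral>x. v x y \<partial>p)) =
        ennreal ((\<integral>x. \<phi> x * w x y \<partial>p)\<^sup>2 / (\<integral>x. w x y \<partial>p))"
      by simp
  qed
qed

abbreviation messages_space :: "'y measure \<Rightarrow> nat \<Rightarrow> (nat \<Rightarrow> 'y) measure" where
  "messages_space \<mu> t \<equiv> \<Pi>\<^sub>M s\<in>{1..t}. \<mu>"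

text \<open>
  \<open>Q\<close> is the law of the public randomness \<open>U\<close> and \<open>R t\<close> that of the private randomness \<open>U\<^sub>t\<close>.
  \<open>W t u v x y\<close> is the law of the message of player \<open>t\<close> who sees \<open>U = u\<close>, \<open>U\<^sub>t = v\<close>, \<open>X\<^sub>t = x\<close> and
  the messages \<open>y\<close> of players \<open>1, \<dots>, t - 1\<close>. For given \<open>(u, v)\<close> it is a channel from pairs
  \<open>(x, y)\<close> to \<open>\<mu>\<close>; joint measurability in all arguments makes the messages random variables.
  Kernels are compared on \<open>space X\<close> only.
\<close>

definition seq_interactive_protocol ::
    "nat \<Rightarrow> 'x measure \<Rightarrow> 'y measure \<Rightarrow> (nat \<Rightarrow> ('x \<Rightarrow> 'y measure) set) \<Rightarrow>
     'u measure \<Rightarrow> (nat \<Rightarrow> 'v measure) \<Rightarrow>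
     (nat \<Rightarrow> 'u \<Rightarrow> 'v \<Rightarrow> 'x \<Rightarrow> (nat \<Rightarrow> 'y) \<Rightarrow> 'y measure) \<Rightarrow> bool" where
  "seq_interactive_protocol n X \<mu> \<W> Q R W \<longleftrightarrow>
     prob_space Q \<and>
     (\<forall>t\<in>{1..n}.
        prob_space (R t) \<and>
        (\<lambda>(u, v, x, y). W t u v x y)
          \<in> Q \<Otimes>\<^sub>M R t \<Otimes>\<^sub>M X \<Otimes>\<^sub>M messages_space \<mu> (t - 1) \<rightarrow>\<^sub>M prob_algebra \<mu> \<and>
        (\<forall>u\<in>space Q. \<forall>v\<in>space (R t).
           (\<lambda>(x, y). W t u v x y) \<in> channels (X \<Otimes>\<^sub>M messages_space \<mu> (t - 1)) \<mu> \<and>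
           (\<forall>y\<in>space (messages_space \<mu> (t - 1)).
              \<exists>V\<in>\<W> t. \<forall>x\<in>space X. W t u v x y = V x)))"

text \<open>
  The law of the first \<open>t\<close> messages for given randomness \<open>u\<close>, \<open>v = (v\<^sub>1, v\<^sub>2, \<dots>)\<close> and given
  inputs \<open>x = (x\<^sub>1, x\<^sub>2, \<dots>)\<close>.
\<close>

primrec messages_given ::
    "'y measure \<Rightarrow> (nat \<Rightarrow> 'u \<Rightarrow> 'v \<Rightarrow> 'x \<Rightarrow> (nat \<Rightarrow> 'y) \<Rightarrow> 'y measure) \<Rightarrow>
     'u \<Rightarrow> (nat \<Rightarrow> 'v) \<Rightarrow> (nat \<Rightarrow> 'x) \<Rightarrow> nat \<Rightarrow> (nat \<Rightarrow> 'y) measure" where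
  "messages_given \<mu> W u v x 0 = return (messages_space \<mu> 0) (\<lambda>_. undefined)"
| "messages_given \<mu> W u v x (Suc t) =
     messages_given \<mu> W u v x t \<bind> (\<lambda>y.
       W (Suc t) u (v (Suc t)) (x (Suc t)) y \<bind> (\<lambda>y'.
         return (messages_space \<mu> (Suc t)) (y(Suc t := y'))))"

text \<open>The law of the transcript \<open>(Y\<^sup>n, U)\<close> for i.i.d. inputs with distribution \<open>p\<close>.\<close>

definition transcript ::
    "nat \<Rightarrow> 'y measure \<Rightarrow> 'u measure \<Rightarrow> (nat \<Rightarrow> 'v measure) \<Rightarrow>
     (nat \<Rightarrow> 'u \<Rightarrow> 'v \<Rightarrow> 'x \<Rightarrow> (nat \<Rightarrow> 'y) \<Rightarrow> 'y measure) \<Rightarrow> 'x measure \<Rightarrow>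
     ((nat \<Rightarrow> 'y) \<times> 'u) measure" where
  "transcript n \<mu> Q R W p =
     (Q \<Otimes>\<^sub>M (\<Pi>\<^sub>M t\<in>{1..n}. R t) \<Otimes>\<^sub>M (\<Pi>\<^sub>M t\<in>{1..n}. p)) \<bind> (\<lambda>(u, v, x).
       messages_given \<mu> W u v x n \<bind> (\<lambda>y. return (messages_space \<mu> n \<Otimes>\<^sub>M Q) (y, u)))"

definition messages_law ::
    "nat \<Rightarrow> 'y measure \<Rightarrow> 'u measure \<Rightarrow> (nat \<Rightarrow> 'v measure) \<Rightarrow>
     (nat \<Rightarrow> 'u \<Rightarrow> 'v \<Rightarrow> 'x \<Rightarrow> (nat \<Rightarrow> 'y) \<Rightarrow> 'y measure) \<Rightarrow> 'x measure \<Rightarrow>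
     (nat \<Rightarrow> 'y) measure" where
  "messages_law n \<mu> Q R W p = distr (transcript n \<mu> Q R W p) (messages_space \<mu> n) fst"

definition cube :: "nat \<Rightarrow> (nat \<Rightarrow> int) set" where
  "cube k = {1..k} \<rightarrow>\<^sub>E {-1, 1}"

definition flip :: "nat \<Rightarrow> (nat \<Rightarrow> int) \<Rightarrow> nat \<Rightarrow> int" where
  "flip i z = z(i := - z i)"

definition Rad :: "real \<Rightarrow> int pmf" where
  "Rad \<tau> = map_pmf (\<lambda>b. if b then 1 else -1) (bernoulli_pmf \<tau>)"

text \<open>With the default value \<open>undefined\<close> outside \<open>{1..k}\<close>, the support lies in \<open>cube k\<close>.\<close>

definition Rad_power :: "nat \<Rightarrow> real \<Rightarrow> (nat \<Rightarrow> int) pmf" where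
  "Rad_power k \<tau> = Pi_pmf {1..k} undefined (\<lambda>_. Rad \<tau>)"

text \<open>
  The expectation \<open>E[f Z]\<close> of a measure-valued function for \<open>Z \<sim> P\<close>. The restriction to the support
  discards the values of \<open>f\<close> elsewhere, which need not be measures on the right space.
\<close>

definition mixture :: "'z pmf \<Rightarrow> ('z \<Rightarrow> 'a measure) \<Rightarrow> 'a measure" where
  "mixture P f = restrict_space (measure_pmf P) (set_pmf P) \<bind> f"

definition tv_dist :: "'a measure \<Rightarrow> 'a measure \<Rightarrow> real" where
  "tv_dist P Q = (SUP A\<in>sets P. \<bar>measure P A - measure Q A\<bar>)"

end

theory Submission
  imports Defs
begin

text \<open>
  For test functions \<open>g\<close> with values in \<open>[-1, 1]\<close>, consider
  \<open>E\<^sub>P[g - g\<^sup>2/2] - E\<^sub>Q[g + g\<^sup>2/2]\<close>, a variational form of the triangular discrimination of \<open>P\<close> and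
  \<open>Q\<close>. If one more message is drawn, replace \<open>g\<close> by its conditional mean \<open>G\<close> under \<open>Q\<close>: Jensen's
  inequality controls the \<open>Q\<close>-part, and AM-GM shows that the \<open>P\<close>-part grows by at most \<open>9/2\<close> times the
  chi-squared divergence of the two conditional message laws. Crucially, this divergence is averaged
  over past messages drawn from \<open>P = P\<^sub>z\<close>, which is the same for all the alternatives
  \<open>Q\<^sub>i = P\<^bsub>flip i z\<^esub>\<close>, so the sum over \<open>i\<close> may be taken before the supremum over channels. Choosing
  \<open>g\<^sub>i = c\<^sub>i (2 1\<^bsub>A\<^esub> - 1)\<close> with \<open>c\<^sub>i = P(A) - Q\<^sub>i(A)\<close> and \<open>A = A\<^sub>i\<close> gives
  \<open>\<Sum>\<^sub>i (P(A\<^sub>i) - Q\<^sub>i(A\<^sub>i))\<^sup>2 \<le> 9/2 \<Sum>\<^sub>t sup \<dots>\<close> for given randomness \<open>(u, v)\<close>. The bound on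
  \<open>\<Sum>\<^sub>i |P(A\<^sub>i) - Q\<^sub>i(A\<^sub>i)|\<close> that follows is uniform in \<open>(u, v)\<close> and \<open>z\<close>, so it survives averaging.
  Since \<open>Z\<close> given \<open>Z\<^sub>i = s\<close> is distributed as \<open>Z(i := s)\<close>, averaging over \<open>z\<close> yields \<open>P\<^sub>+\<^sub>i\<close> and \<open>P\<^sub>-\<^sub>i\<close>.
\<close>

section \<open>Integrals against mixtures of kernels\<close>

text \<open>Tower rule in the form used for all later kernels. Every test function below is bounded
  on the space, and membership in \<open>space (prob_algebra A)\<close> records the sigma-algebra
  and the total mass 1 together, so no integrability has to be carried along.\<close>

lemma integral_bind_prob_algebra:
  fixes f :: "'b \<Rightarrow> real"
  assumes M: "M \<in> space (prob_algebra A)" and N: "N \<in> A \<rightarrow>\<^sub>M prob_algebra B"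
    and f: "f \<in> borel_measurable B" and bound: "\<And>y. y \<in> space B \<Longrightarrow> \<bar>f y\<bar> \<le> c"
  shows "(\<integral>y. f y \<partial>(M \<bind> N)) = (\<integral>x. (\<integral>y. f y \<partial>N x) \<partial>M)"
proof -
  have [measurable_cong]: "sets M = sets A" and "prob_space M"
    using M by (auto simp: space_prob_algebra)
  then interpret prob_space M by simp
  have N': "N \<in> M \<rightarrow>\<^sub>M subprob_algebra B"
    using measurable_prob_algebraD[OF N] by measurable
  have "prob_space (N x)" if "x \<in> space M" for x
    using measurable_space[OF N] that sets_eq_imp_space_eq[OF \<open>sets M = sets A\<close>]
    by (auto simp: space_prob_algebra)
  then show ?thesis
    using bound
    by (intro integral_bind[OF f _ N', where B = c and B' = 1])
       (auto intro!: AE_I2 finite_measure_axioms simp: prob_space.emeasure_space_1)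
qed

lemma integrable_bounded_prob_algebra:
  fixes f :: "'b \<Rightarrow> real"
  assumes M: "M \<in> space (prob_algebra A)"
    and f: "f \<in> borel_measurable A" and bound: "\<And>y. y \<in> space A \<Longrightarrow> \<bar>f y\<bar> \<le> c"
  shows "integrable M f"
proof -
  have [measurable_cong]: "sets M = sets A" and "prob_space M"
    using M by (auto simp: space_prob_algebra)
  then interpret prob_space M by simp
  show ?thesis
    using f bound sets_eq_imp_space_eq[OF \<open>sets M = sets A\<close>]
    by (intro integrable_const_bound[where B = c]) (auto intro!: AE_I2)
qed

lemma abs_integral_le_prob_algebra:
  fixes f :: "'b \<Rightarrow> real"
  assumes M: "M \<in> space (prob_algebra A)"
    and f: "f \<in> borel_measurable A" and bound: "\<And>y. y \<in> space A \<Longrightarrow> \<bar>f y\<bar> \<le> c"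
  shows "\<bar>\<integral>y. f y \<partial>M\<bar> \<le> c"
proof -
  have s: "sets M = sets A" and "prob_space M"
    using M by (auto simp: space_prob_algebra)
  then interpret prob_space M by simp
  have i: "integrable M f" by (rule integrable_bounded_prob_algebra[OF assms])
  have b: "\<bar>f y\<bar> \<le> c" if "y \<in> space M" for y
    using bound that sets_eq_imp_space_eq[OF s] by auto
  have "(\<integral>y. f y \<partial>M) \<le> c"
    by (rule integral_le_const[OF i]) (use b in \<open>auto intro!: AE_I2 simp: abs_le_iff\<close>)
  moreover have "- c \<le> (\<integral>y. f y \<partial>M)"
    by (rule integral_ge_const[OF i]) (use b in \<open>auto intro!: AE_I2 simp: abs_le_iff minus_le_iff\<close>)
  ultimately show ?thesis by auto
qed

text \<open>Each \<open>w x\<close> integrates to 1, so \<theta>(x) w(x, y) has on the product space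
  the L1-norm of \<theta>, and Fubini applies. With \<theta> = 1 this yields the output density
  under \<open>p\<close>, with \<theta> = \<psi> below the change of that density when
  \<open>p\<close> is replaced by \<open>q\<close>. The third conclusion guards against the
  convention that the Bochner integral of a nonintegrable function is 0.\<close>

lemma
  fixes \<theta> :: "'a \<Rightarrow> real" and h :: "'b \<Rightarrow> real"
  assumes mu: "sigma_finite_measure \<mu>" and p: "prob_space p" "sets p = sets X"
    and V: "V \<in> X \<rightarrow>\<^sub>M prob_algebra \<mu>" and w: "transition_density X \<mu> V w"
    and \<theta>: "integrable p \<theta>" and h: "h \<in> borel_measurable \<mu>" and bound: "\<And>y. y \<in> space \<mu> \<Longrightarrow> \<bar>h y\<bar> \<le> c"
  shows integral_transition_density:
      "(\<integral>x. \<theta> x * (\<integral>y. h y \<partial>V x) \<partial>p) = (\<integral>y. h y * (\<integral>x. \<theta> x * w x y \<partial>p) \<partial>\<mu>)"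
    and integrable_transition_density: "integrable \<mu> (\<lambda>y. h y * (\<integral>x. \<theta> x * w x y \<partial>p))"
    and AE_integrable_transition_density: "AE y in \<mu>. integrable p (\<lambda>x. \<theta> x * w x y)"
proof -
  interpret mu: sigma_finite_measure \<mu> by fact
  interpret p: prob_space p by fact
  interpret pair_sigma_finite p \<mu> ..
  note [measurable_cong] = \<open>sets p = sets X\<close>
  have space_p: "space p = space X" using p(2) by (rule sets_eq_imp_space_eq)
  have [measurable]: "(\<lambda>(x, y). w x y) \<in> borel_measurable (X \<Otimes>\<^sub>M \<mu>)"
    and w0: "\<And>x y. x \<in> space X \<Longrightarrow> y \<in> space \<mu> \<Longrightarrow> 0 \<le> w x y"
    and Vw: "\<And>x. x \<in> space X \<Longrightarrow> V x = density \<mu> (\<lambda>y. ennreal (w x y))"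
    using w by (auto simp: transition_density_def)
  have [measurable]: "w x \<in> borel_measurable \<mu>" if "x \<in> space X" for x
    using that by measurable
  have [measurable]: "\<theta> \<in> borel_measurable p" "h \<in> borel_measurable \<mu>"
    using \<theta> h by auto
  have w_int: "integrable \<mu> (w x)" "(\<integral>y. w x y \<partial>\<mu>) = 1" if x: "x \<in> space X" for x
  proof -
    have "prob_space (V x)"
      using measurable_space[OF V x] by (simp add: space_prob_algebra)
    then have "emeasure (density \<mu> (\<lambda>y. ennreal (w x y))) (space \<mu>) = 1"
      using prob_space.emeasure_space_1[of "V x"] Vw[OF x] by simp
    then have "(\<integral>\<^sup>+ y. ennreal (w x y) \<partial>\<mu>) = 1"
      using x by (subst (asm) emeasure_density) (auto cong: nn_integral_cong)
    then have "has_bochner_integral \<mu> (w x) 1"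
      using x w0 by (intro has_bochner_integral_nn_integral) (auto intro!: AE_I2)
    then show "integrable \<mu> (w x)" "(\<integral>y. w x y \<partial>\<mu>) = 1"
      by (auto simp: has_bochner_integral_iff)
  qed
  have int1: "integrable (p \<Otimes>\<^sub>M \<mu>) (\<lambda>(x, y). \<theta> x * w x y)"
  proof (rule Fubini_integrable)
    have "(\<integral>y. norm (case (x, y) of (x, y) \<Rightarrow> \<theta> x * w x y) \<partial>\<mu>) = \<bar>\<theta> x\<bar>" if "x \<in> space p" for x
    proof -
      have "(\<integral>y. norm (case (x, y) of (x, y) \<Rightarrow> \<theta> x * w x y) \<partial>\<mu>) = (\<integral>y. \<bar>\<theta> x\<bar> * w x y \<partial>\<mu>)"
        using that w0 space_p by (intro Bochner_Integration.integral_cong) (auto simp: abs_mult)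
      then show ?thesis using w_int that space_p by simp
    qed
    moreover have "integrable p (\<lambda>x. \<bar>\<theta> x\<bar>)" using \<theta> by simp
    ultimately show "integrable p (\<lambda>x. \<integral>y. norm (case (x, y) of (x, y) \<Rightarrow> \<theta> x * w x y) \<partial>\<mu>)"
      by (simp cong: Bochner_Integration.integrable_cong)
    show "AE x in p. integrable \<mu> (\<lambda>y. case (x, y) of (x, y) \<Rightarrow> \<theta> x * w x y)"
      using w_int space_p by (auto intro!: AE_I2)
  qed measurable
  then show "AE y in \<mu>. integrable p (\<lambda>x. \<theta> x * w x y)"
    by (rule AE_integrable_snd)
  have int2: "integrable (p \<Otimes>\<^sub>M \<mu>) (\<lambda>(x, y). h y * (\<theta> x * w x y))"
  proof (rule Bochner_Integration.integrable_bound[where f = "\<lambda>q. c * (case q of (x, y) \<Rightarrow> \<theta> x * w x y)"])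
    show "integrable (p \<Otimes>\<^sub>M \<mu>) (\<lambda>q. c * (case q of (x, y) \<Rightarrow> \<theta> x * w x y))"
      using int1 by simp
    show "AE q in p \<Otimes>\<^sub>M \<mu>. norm (case q of (x, y) \<Rightarrow> h y * (\<theta> x * w x y))
        \<le> norm (c * (case q of (x, y) \<Rightarrow> \<theta> x * w x y))"
    proof (intro AE_I2, clarify)
      fix x y assume "(x, y) \<in> space (p \<Otimes>\<^sub>M \<mu>)"
      then have "\<bar>h y\<bar> \<le> c" using bound by (auto simp: space_pair_measure)
      then have "\<bar>h y\<bar> * \<bar>\<theta> x * w x y\<bar> \<le> \<bar>c\<bar> * \<bar>\<theta> x * w x y\<bar>"
        by (intro mult_right_mono) auto
      then show "norm (h y * (\<theta> x * w x y)) \<le> norm (c * (\<theta> x * w x y))"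
        by (simp add: abs_mult)
    qed
  qed measurable
  show "integrable \<mu> (\<lambda>y. h y * (\<integral>x. \<theta> x * w x y \<partial>p))"
    using integrable_snd[OF int2] by simp
  have "(\<integral>y. h y \<partial>V x) = (\<integral>y. h y * w x y \<partial>\<mu>)" if "x \<in> space p" for x
    using that w0 space_p Vw
    by (subst Vw) (auto simp: integral_density mult.commute intro!: AE_I2 Bochner_Integration.integral_cong)
  then have "(\<integral>x. \<theta> x * (\<integral>y. h y \<partial>V x) \<partial>p) = (\<integral>x. (\<integral>y. h y * (\<theta> x * w x y) \<partial>\<mu>) \<partial>p)"
    by (intro Bochner_Integration.integral_cong)
       (auto simp: mult.left_commute simp flip: Bochner_Integration.integral_mult_right_zero)
  also have "\<dots> = (\<integral>y. (\<integral>x. h y * (\<theta> x * w x y) \<partial>p) \<partial>\<mu>)"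
    by (rule Fubini_integral[symmetric, OF int2])
  finally show "(\<integral>x. \<theta> x * (\<integral>y. h y \<partial>V x) \<partial>p) = (\<integral>y. h y * (\<integral>x. \<theta> x * w x y \<partial>p) \<partial>\<mu>)"
    by simp
qed

section \<open>A single message\<close>

text \<open>Let A and S be the first and second moments of \<open>g\<close> under
  \<open>p \<bind> V\<close>, G the mean under \<open>q \<bind> V\<close>, and C = G - A. Replacing
  A by G costs at most 3 |C|, while passing from S to A squared gains half the variance of
  \<open>g\<close>. Since C is the integral of g - A against the difference of the output densities,
  this gain pays for the cost up to a multiple of the chi-squared integral. In \<open>d\<close> the
  factor \<open>a\<^sup>2\<close> is multiplied in \<open>ennreal\<close>, so a vanishing
  \<open>a\<close> also covers an infinite integral.\<close>

lemma message_functional_le: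
  fixes g :: "'b \<Rightarrow> real" and \<phi> :: "'a \<Rightarrow> real" and a d :: real
  assumes mu: "sigma_finite_measure \<mu>" and p: "prob_space p" "sets p = sets X"
    and q: "prob_space q" "sets q = sets X" and ac: "absolutely_continuous p q"
    and \<phi>: "\<phi> \<in> borel_measurable X"
    and RN: "AE x in p. enn2real (RN_deriv p q x) = 1 + a * \<phi> x"
    and V: "V \<in> X \<rightarrow>\<^sub>M prob_algebra \<mu>" and w: "transition_density X \<mu> V w"
    and g: "g \<in> borel_measurable \<mu>" "\<And>y. y \<in> space \<mu> \<Longrightarrow> \<bar>g y\<bar> \<le> 1"
    and d: "ennreal (a\<^sup>2) * (\<integral>\<^sup>+ y. ennreal ((\<integral>x. \<phi> x * w x y \<partial>p)\<^sup>2 / (\<integral>x. w x y \<partial>p)) \<partial>\<mu>) \<le> ennreal d"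
      "0 \<le> d"
  shows "(\<integral>y. g y - (g y)\<^sup>2 / 2 \<partial>(p \<bind> V))
    \<le> (\<integral>y. g y \<partial>(q \<bind> V)) - (\<integral>y. g y \<partial>(q \<bind> V))\<^sup>2 / 2 + 9 / 2 * d"
proof -
  interpret mu: sigma_finite_measure \<mu> by fact
  interpret p: prob_space p by fact
  interpret q: prob_space q by fact
  note [measurable_cong] = p(2) q(2)
  note [measurable] = g(1) \<phi>
  have pX: "p \<in> space (prob_algebra X)" and qX: "q \<in> space (prob_algebra X)"
    using p q by (auto simp: space_prob_algebra)
  have space_p: "space p = space X" using p(2) by (rule sets_eq_imp_space_eq)
  have [measurable]: "(\<lambda>(x, y). w x y) \<in> borel_measurable (X \<Otimes>\<^sub>M \<mu>)"
    and w0: "\<And>x y. x \<in> space X \<Longrightarrow> y \<in> space \<mu> \<Longrightarrow> 0 \<le> w x y"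
    using w by (auto simp: transition_density_def)
  have sets_qp: "sets q = sets p" using p q by simp
  have Vm: "V \<in> X \<rightarrow>\<^sub>M subprob_algebra \<mu>" using V by (rule measurable_prob_algebraD)
  define \<psi> where "\<psi> x = a * \<phi> x" for x
  have \<psi>m[measurable]: "\<psi> \<in> borel_measurable p" unfolding \<psi>_def by measurable
  have RN': "AE x in p. enn2real (RN_deriv p q x) = 1 + \<psi> x"
    using RN by (simp add: \<psi>_def)
  \<comment> \<open>Change of measure for every measurable \<open>f\<close>, integrable or
    not.\<close>
  have q_int: "(\<integral>x. f x \<partial>q) = (\<integral>x. (1 + \<psi> x) * f x \<partial>p)" if [measurable]: "f \<in> borel_measurable p" for f
  proof -
    have "(\<integral>x. f x \<partial>q) = (\<integral>x. enn2real (RN_deriv p q x) * f x \<partial>p)"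
      by (rule p.RN_deriv_integral[OF q.sigma_finite_measure_axioms ac sets_qp]) fact
    also have "\<dots> = (\<integral>x. (1 + \<psi> x) * f x \<partial>p)"
      by (rule integral_cong_AE) (use RN' in auto)
    finally show ?thesis .
  qed
  \<comment> \<open>\<phi> is only assumed measurable; integrability of \<psi> comes from 1 + \<psi>
    being the density of a probability measure.\<close>
  have "integrable p (\<lambda>x. enn2real (RN_deriv p q x) * 1)"
    by (subst p.RN_deriv_integrable[OF q.sigma_finite_measure_axioms ac sets_qp, symmetric]) auto
  then have "integrable p (\<lambda>x. 1 + \<psi> x)"
    by (rule integrable_cong_AE_imp) (use RN' in \<open>auto simp: eq_commute\<close>)
  then have "integrable p (\<lambda>x. (1 + \<psi> x) - 1)"
    by (rule Bochner_Integration.integrable_diff) simp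
  then have \<psi>: "integrable p \<psi>" by simp
  have \<psi>0: "(\<integral>x. \<psi> x \<partial>p) = 0"
    using q_int[of "\<lambda>_. 1"] \<psi> by (simp add: q.prob_space p.prob_space)
  have Eh: "(\<lambda>x. \<integral>y. h y \<partial>V x) \<in> borel_measurable p" if [measurable]: "h \<in> borel_measurable \<mu>" for h :: "'b \<Rightarrow> real"
    using Vm by measurable

  \<comment> \<open>\<open>P\<close> is the density of the message when the input has law
    \<open>p\<close>, and \<open>P + D\<close> the one when it has law \<open>q\<close>.\<close>
  define P where "P y = (\<integral>x. w x y \<partial>p)" for y
  define D where "D y = (\<integral>x. \<psi> x * w x y \<partial>p)" for y
  have pair_p: "(\<integral>y. h y \<partial>(p \<bind> V)) = (\<integral>y. h y * P y \<partial>\<mu>)" "integrable \<mu> (\<lambda>y. h y * P y)"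
    and pair_q: "(\<integral>y. h y \<partial>(q \<bind> V)) = (\<integral>y. h y \<partial>(p \<bind> V)) + (\<integral>y. h y * D y \<partial>\<mu>)"
      "integrable \<mu> (\<lambda>y. h y * D y)"
    if h[measurable]: "h \<in> borel_measurable \<mu>" and c: "\<And>y. y \<in> space \<mu> \<Longrightarrow> \<bar>h y\<bar> \<le> c" for h c
  proof -
    have e: "(\<integral>y. h y \<partial>(p \<bind> V)) = (\<integral>x. (\<integral>y. h y \<partial>V x) \<partial>p)"
      by (rule integral_bind_prob_algebra[OF pX V h c])
    then show "(\<integral>y. h y \<partial>(p \<bind> V)) = (\<integral>y. h y * P y \<partial>\<mu>)"
      using integral_transition_density[OF mu p V w _ h c, of "\<lambda>_. 1"] by (simp add: P_def)
    show "integrable \<mu> (\<lambda>y. h y * P y)"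
      using integrable_transition_density[OF mu p V w _ h c, of "\<lambda>_. 1"] by (simp add: P_def)
    have Vc: "\<bar>\<integral>y. h y \<partial>V x\<bar> \<le> c" if "x \<in> space p" for x
      using measurable_space[OF V, of x] that space_p
      by (intro abs_integral_le_prob_algebra[OF _ h c]) auto
    have "integrable p (\<lambda>x. \<integral>y. h y \<partial>V x)"
      by (intro p.integrable_const_bound[where B = c] AE_I2 Eh h) (use Vc in auto)
    moreover have "integrable p (\<lambda>x. \<psi> x * (\<integral>y. h y \<partial>V x))"
    proof (rule Bochner_Integration.integrable_bound[where f = "\<lambda>x. c * \<psi> x"])
      show "AE x in p. norm (\<psi> x * (\<integral>y. h y \<partial>V x)) \<le> norm (c * \<psi> x)"
      proof (intro AE_I2)
        fix x assume x: "x \<in> space p"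
        have "\<bar>\<psi> x\<bar> * \<bar>\<integral>y. h y \<partial>V x\<bar> \<le> \<bar>\<psi> x\<bar> * \<bar>c\<bar>"
          using Vc[OF x] by (intro mult_left_mono) auto
        then show "norm (\<psi> x * (\<integral>y. h y \<partial>V x)) \<le> norm (c * \<psi> x)"
          by (simp add: abs_mult mult.commute)
      qed
    qed (use \<psi> Eh h in auto)
    moreover have "(\<integral>y. h y \<partial>(q \<bind> V)) = (\<integral>x. (1 + \<psi> x) * (\<integral>y. h y \<partial>V x) \<partial>p)"
      by (subst integral_bind_prob_algebra[OF qX V h c]) (auto intro: q_int Eh h)
    ultimately have "(\<integral>y. h y \<partial>(q \<bind> V)) = (\<integral>x. (\<integral>y. h y \<partial>V x) \<partial>p) + (\<integral>x. \<psi> x * (\<integral>y. h y \<partial>V x) \<partial>p)"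
      by (simp add: distrib_right)
    then show "(\<integral>y. h y \<partial>(q \<bind> V)) = (\<integral>y. h y \<partial>(p \<bind> V)) + (\<integral>y. h y * D y \<partial>\<mu>)"
      using e integral_transition_density[OF mu p V w \<psi> h c] by (simp add: D_def)
    show "integrable \<mu> (\<lambda>y. h y * D y)"
      using integrable_transition_density[OF mu p V w \<psi> h c] by (simp add: D_def)
  qed
  have [measurable]: "P \<in> borel_measurable \<mu>" "D \<in> borel_measurable \<mu>"
    using pair_p(2)[of "\<lambda>_. 1" 1] pair_q(2)[of "\<lambda>_. 1" 1] by auto

  have bindV: "r \<bind> V \<in> space (prob_algebra \<mu>)" if "r \<in> space (prob_algebra X)" for r
    using prob_space_bind'[OF that V] sets_bind'[OF that V] by (simp add: space_prob_algebra)
  define A where "A = (\<integral>y. g y \<partial>(p \<bind> V))"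
  define G where "G = (\<integral>y. g y \<partial>(q \<bind> V))"
  define S where "S = (\<integral>y. (g y)\<^sup>2 \<partial>(p \<bind> V))"
  define C where "C = (\<integral>y. g y * D y \<partial>\<mu>)"
  have gA: "\<bar>A\<bar> \<le> 1" "\<bar>G\<bar> \<le> 1"
    unfolding A_def G_def
    using abs_integral_le_prob_algebra[OF bindV[OF pX] g] abs_integral_le_prob_algebra[OF bindV[OF qX] g]
    by auto
  have G: "G = A + C"
    unfolding G_def A_def C_def by (rule pair_q(1)[OF g])
  have sq: "\<bar>(g y)\<^sup>2\<bar> \<le> 1" if "y \<in> space \<mu>" for y
    using g(2)[OF that] by (simp add: abs_square_le_1)
  have lin: "(\<integral>y. g y - (g y)\<^sup>2 / 2 \<partial>(p \<bind> V)) = A - S / 2"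
    unfolding A_def S_def
    using integrable_bounded_prob_algebra[OF bindV[OF pX] g]
      integrable_bounded_prob_algebra[OF bindV[OF pX] borel_measurable_power[OF g(1)] sq]
    by simp
  have P1: "(\<integral>y. P y \<partial>\<mu>) = 1"
  proof -
    interpret pV: prob_space "p \<bind> V" using bindV[OF pX] by (simp add: space_prob_algebra)
    show ?thesis using pair_p(1)[of "\<lambda>_. 1" 1] by (simp add: pV.prob_space)
  qed
  have D0: "(\<integral>y. D y \<partial>\<mu>) = 0"
  proof -
    interpret pV: prob_space "p \<bind> V" using bindV[OF pX] by (simp add: space_prob_algebra)
    interpret qV: prob_space "q \<bind> V" using bindV[OF qX] by (simp add: space_prob_algebra)
    show ?thesis using pair_q(1)[of "\<lambda>_. 1" 1] by (simp add: pV.prob_space qV.prob_space)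
  qed
  have "integrable \<mu> P" "integrable \<mu> D" "integrable \<mu> (\<lambda>y. g y * P y)" "integrable \<mu> (\<lambda>y. g y * D y)"
    "integrable \<mu> (\<lambda>y. (g y)\<^sup>2 * P y)"
    using pair_p(2)[of "\<lambda>_. 1" 1] pair_q(2)[of "\<lambda>_. 1" 1] pair_p(2)[OF g] pair_q(2)[OF g]
      pair_p(2)[OF _ sq] by auto
  note ints = this
  have var: "(\<integral>y. (g y - A)\<^sup>2 * P y \<partial>\<mu>) = S - A\<^sup>2" "integrable \<mu> (\<lambda>y. (g y - A)\<^sup>2 * P y)"
  proof -
    have *: "(g y - A)\<^sup>2 * P y = (g y)\<^sup>2 * P y - 2 * A * (g y * P y) + A\<^sup>2 * P y" for y
      by (simp add: power2_eq_square algebra_simps)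
    show "integrable \<mu> (\<lambda>y. (g y - A)\<^sup>2 * P y)"
      unfolding * using ints by simp
    have "(\<integral>y. (g y)\<^sup>2 * P y \<partial>\<mu>) = S" "(\<integral>y. g y * P y \<partial>\<mu>) = A"
      unfolding S_def A_def by (auto simp: pair_p(1)[OF g] pair_p(1)[OF _ sq])
    then show "(\<integral>y. (g y - A)\<^sup>2 * P y \<partial>\<mu>) = S - A\<^sup>2"
      unfolding * using ints P1 by (simp add: power2_eq_square)
  qed
  \<comment> \<open>Both densities have mass 1, so \<open>D\<close> integrates to 0 and
    \<open>g\<close> may be centred at A without changing C.\<close>
  have C: "(\<integral>y. (g y - A) * D y \<partial>\<mu>) = C" "integrable \<mu> (\<lambda>y. (g y - A) * D y)"
    using ints D0 by (auto simp: left_diff_distrib C_def)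

  define I where "I y = (D y)\<^sup>2 / P y" for y
  have P0: "0 \<le> P y" if "y \<in> space \<mu>" for y
    unfolding P_def using that w0 space_p by (intro integral_nonneg_AE) (auto intro!: AE_I2)
  have [measurable]: "I \<in> borel_measurable \<mu>" unfolding I_def by measurable
  have "(\<integral>\<^sup>+ y. ennreal (I y) \<partial>\<mu>) \<le> ennreal d"
  proof -
    have "(\<integral>\<^sup>+ y. ennreal (I y) \<partial>\<mu>) = (\<integral>\<^sup>+ y. ennreal (a\<^sup>2) * ennreal ((\<integral>x. \<phi> x * w x y \<partial>p)\<^sup>2 / (\<integral>x. w x y \<partial>p)) \<partial>\<mu>)"
    proof (rule nn_integral_cong)
      fix y assume y: "y \<in> space \<mu>"
      have "D y = a * (\<integral>x. \<phi> x * w x y \<partial>p)"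
        unfolding D_def \<psi>_def by (simp add: mult.assoc)
      then have "I y = a\<^sup>2 * ((\<integral>x. \<phi> x * w x y \<partial>p)\<^sup>2 / (\<integral>x. w x y \<partial>p))"
        by (simp add: I_def P_def power_mult_distrib)
      then show "ennreal (I y) = ennreal (a\<^sup>2) * ennreal ((\<integral>x. \<phi> x * w x y \<partial>p)\<^sup>2 / (\<integral>x. w x y \<partial>p))"
        using P0[OF y] by (simp add: ennreal_mult' P_def del: times_divide_eq_right)
    qed
    also have "\<dots> = ennreal (a\<^sup>2) * (\<integral>\<^sup>+ y. ennreal ((\<integral>x. \<phi> x * w x y \<partial>p)\<^sup>2 / (\<integral>x. w x y \<partial>p)) \<partial>\<mu>)"
    proof (rule nn_integral_cmult)
      show "(\<lambda>y. ennreal ((\<integral>x. \<phi> x * w x y \<partial>p)\<^sup>2 / (\<integral>x. w x y \<partial>p))) \<in> borel_measurable \<mu>"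
        by measurable
    qed
    finally show ?thesis using d(1) by simp
  qed
  then have I: "integrable \<mu> I" "(\<integral>y. I y \<partial>\<mu>) \<le> d"
  proof -
    assume le: "(\<integral>\<^sup>+ y. ennreal (I y) \<partial>\<mu>) \<le> ennreal d"
    have I0: "AE y in \<mu>. 0 \<le> I y"
      using P0 by (auto intro!: AE_I2 simp: I_def)
    show "integrable \<mu> I"
      using le I0 by (intro integrableI_nonneg) (auto simp: le_less_trans[OF _ ennreal_less_top])
    show "(\<integral>y. I y \<partial>\<mu>) \<le> d"
      using le I0 d(2) by (subst integral_eq_nn_integral) (auto intro!: enn2real_leI)
  qed

  \<comment> \<open>The functional provides exactly half of the variance term, and balancing the
    factor 3 against the weight 1/2 gives 9/2. Where \<open>P y = 0\<close>, the quotient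
    \<open>I y\<close> is 0 by the division convention, so \<open>D y = 0\<close> is needed there:
    for almost every y the nonnegative function w(., y) is integrable, and then a zero integral
    makes it vanish almost everywhere.\<close>
  have amgm: "AE y in \<mu>. 3 * \<bar>(g y - A) * D y\<bar> \<le> 9 / 2 * I y + (g y - A)\<^sup>2 * P y / 2"
    using AE_integrable_transition_density[OF mu p V w, of "\<lambda>_. 1" "\<lambda>_. 0" 0, simplified] AE_space
  proof eventually_elim
    case (elim y)
    have wm: "(\<lambda>x. w x y) \<in> borel_measurable p"
      using elim(1) by auto
    show ?case
    proof (cases "P y = 0")
      case True
      then have "AE x in p. w x y = 0"
        using elim w0 space_p
        by (subst (asm) P_def, subst (asm) integral_nonneg_eq_0_iff_AE) (auto intro!: AE_I2)
      then have "D y = (\<integral>x. 0 \<partial>p)"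
        unfolding D_def using wm by (intro integral_cong_AE) auto
      then show ?thesis using True by (simp add: I_def)
    next
      case False
      then have pos: "0 < P y" using P0[OF elim(2)] by simp
      have "0 \<le> (3 * \<bar>D y\<bar> - \<bar>g y - A\<bar> * P y)\<^sup>2 / (2 * P y)"
        using pos by simp
      also have "\<dots> = 9 / 2 * (\<bar>D y\<bar>\<^sup>2 / P y) + \<bar>g y - A\<bar>\<^sup>2 * P y / 2 - 3 * (\<bar>g y - A\<bar> * \<bar>D y\<bar>)"
        using pos by (simp add: power2_eq_square field_simps)
      also have "\<dots> = 9 / 2 * I y + (g y - A)\<^sup>2 * P y / 2 - 3 * \<bar>(g y - A) * D y\<bar>"
        by (simp add: I_def abs_mult)
      finally show ?thesis by simp
    qed
  qed
  have "3 * \<bar>C\<bar> \<le> 3 * (\<integral>y. \<bar>(g y - A) * D y\<bar> \<partial>\<mu>)"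
    using C by (metis integral_abs_bound mult_left_mono zero_le_numeral)
  also have "\<dots> = (\<integral>y. 3 * \<bar>(g y - A) * D y\<bar> \<partial>\<mu>)"
    by simp
  also have "\<dots> \<le> (\<integral>y. 9 / 2 * I y + (g y - A)\<^sup>2 * P y / 2 \<partial>\<mu>)"
    by (rule integral_mono_AE) (use amgm I(1) var(2) C(2) in auto)
  also have "\<dots> = 9 / 2 * (\<integral>y. I y \<partial>\<mu>) + (S - A\<^sup>2) / 2"
    using I(1) var by simp
  also have "\<dots> \<le> 9 / 2 * d + (S - A\<^sup>2) / 2"
    using I(2) by simp
  finally have key: "3 * \<bar>C\<bar> \<le> 9 / 2 * d + (S - A\<^sup>2) / 2" .
  \<comment> \<open>\<open>E\<close> is the exact loss in passing from A - A^2/2 to G - G^2/2. The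
    bounds |1 - A| \<le> 2 and |C| \<le> 2 give 2 |C| + |C|, which is where the factor 3 in the
    AM-GM step comes from.\<close>
  define E where "E = - C * (1 - A) + C\<^sup>2 / 2"
  have "E \<le> 3 * \<bar>C\<bar>"
  proof -
    have "\<bar>C\<bar> \<le> 2" using G gA by auto
    then have "\<bar>C\<bar> * \<bar>C\<bar> \<le> \<bar>C\<bar> * 2" by (intro mult_left_mono) auto
    moreover have "C\<^sup>2 = \<bar>C\<bar> * \<bar>C\<bar>" by (simp add: power2_eq_square)
    moreover have "- C * (1 - A) \<le> \<bar>C\<bar> * \<bar>1 - A\<bar>" by (metis abs_ge_self abs_minus_cancel abs_mult)
    moreover have "\<bar>C\<bar> * \<bar>1 - A\<bar> \<le> \<bar>C\<bar> * 2" using gA by (intro mult_left_mono) auto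
    ultimately show ?thesis unfolding E_def by linarith
  qed
  moreover have "G - G\<^sup>2 / 2 = A - A\<^sup>2 / 2 - E"
    by (simp add: E_def G power2_eq_square field_simps)
  ultimately have "A - S / 2 \<le> G - G\<^sup>2 / 2 + 9 / 2 * d"
    using key by (simp add: diff_divide_distrib)
  then show ?thesis by (simp add: lin G_def)
qed

section \<open>Messages for given randomness\<close>

text \<open>In \<open>messages_given\<close> all inputs are fixed beforehand. An input is read only
  in its own round, so here it is integrated out on the spot. For given past messages, the next one
  is then the output of a single channel on an input with law \<open>p\<close>, which is the
  situation of the one-message estimate.\<close>

primrec round_law ::
    "'y measure \<Rightarrow> (nat \<Rightarrow> 'x \<Rightarrow> (nat \<Rightarrow> 'y) \<Rightarrow> 'y measure) \<Rightarrow> 'x measure \<Rightarrow> nat \<Rightarrow> (nat \<Rightarrow> 'y) measure" where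
  "round_law \<mu> K p 0 = return (messages_space \<mu> 0) (\<lambda>_. undefined)"
| "round_law \<mu> K p (Suc t) = round_law \<mu> K p t \<bind> (\<lambda>y.
     (p \<bind> (\<lambda>x. K (Suc t) x y)) \<bind> (\<lambda>y'. return (messages_space \<mu> (Suc t)) (y(Suc t := y'))))"

lemma measurable_append_message [measurable]:
  "(\<lambda>(y, y'). y(Suc t := y')) \<in> messages_space \<mu> t \<Otimes>\<^sub>M \<mu> \<rightarrow>\<^sub>M messages_space \<mu> (Suc t)"
proof -
  have "{1..Suc t} = insert (Suc t) {1..t}" by auto
  then show ?thesis
    using measurable_add_dim[of "Suc t" "{1..t}" "\<lambda>_. \<mu>"] by simp
qed

locale round_kernels =
  fixes n :: nat and X :: "'x measure" and \<mu> :: "'y measure"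
    and K :: "nat \<Rightarrow> 'x \<Rightarrow> (nat \<Rightarrow> 'y) \<Rightarrow> 'y measure"
  assumes kernel: "t \<in> {1..n} \<Longrightarrow>
    (\<lambda>(x, y). K t x y) \<in> X \<Otimes>\<^sub>M messages_space \<mu> (t - 1) \<rightarrow>\<^sub>M prob_algebra \<mu>"
begin

lemma measurable_message_law:
  assumes "Suc t \<le> n" and p: "p \<in> space (prob_algebra X)"
  shows "(\<lambda>y. p \<bind> (\<lambda>x. K (Suc t) x y)) \<in> messages_space \<mu> t \<rightarrow>\<^sub>M prob_algebra \<mu>"
proof (rule measurable_bind_prob_space2[OF measurable_const[OF p]])
  have [measurable]: "(\<lambda>(x, y). K (Suc t) x y) \<in> X \<Otimes>\<^sub>M messages_space \<mu> t \<rightarrow>\<^sub>M prob_algebra \<mu>"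
    using kernel[of "Suc t"] assms(1) by simp
  show "(\<lambda>(y, x). K (Suc t) x y) \<in> messages_space \<mu> t \<Otimes>\<^sub>M X \<rightarrow>\<^sub>M prob_algebra \<mu>"
    by measurable
qed

lemma measurable_append_law:
  assumes "Suc t \<le> n" and p: "p \<in> space (prob_algebra X)"
  shows "(\<lambda>y. (p \<bind> (\<lambda>x. K (Suc t) x y)) \<bind> (\<lambda>y'. return (messages_space \<mu> (Suc t)) (y(Suc t := y'))))
    \<in> messages_space \<mu> t \<rightarrow>\<^sub>M prob_algebra (messages_space \<mu> (Suc t))"
proof (rule measurable_bind_prob_space2[OF measurable_message_law[OF assms]])
  show "(\<lambda>(y, y'). return (messages_space \<mu> (Suc t)) (y(Suc t := y')))
      \<in> messages_space \<mu> t \<Otimes>\<^sub>M \<mu> \<rightarrow>\<^sub>M prob_algebra (messages_space \<mu> (Suc t))"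
    using measurable_compose[OF measurable_append_message measurable_return_prob_space]
    by (simp add: case_prod_beta')
qed

lemma round_law_in_prob_algebra:
  assumes "t \<le> n" and p: "p \<in> space (prob_algebra X)"
  shows "round_law \<mu> K p t \<in> space (prob_algebra (messages_space \<mu> t))"
  using assms(1)
proof (induction t)
  case 0
  then show ?case
    by (auto simp: space_prob_algebra space_PiM intro!: prob_space_return)
next
  case (Suc t)
  then have t: "Suc t \<le> n" and IH: "round_law \<mu> K p t \<in> space (prob_algebra (messages_space \<mu> t))"
    by auto
  show ?case
    using prob_space_bind'[OF IH measurable_append_law[OF t p]]
      sets_bind'[OF IH measurable_append_law[OF t p]]
    by (simp add: space_prob_algebra)
qed

lemma integral_append_law:
  fixes f :: "(nat \<Rightarrow> 'y) \<Rightarrow> real"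
  assumes t: "Suc t \<le> n" and p: "p \<in> space (prob_algebra X)"
    and f: "f \<in> borel_measurable (messages_space \<mu> (Suc t))"
    and c: "\<And>y. y \<in> space (messages_space \<mu> (Suc t)) \<Longrightarrow> \<bar>f y\<bar> \<le> c"
    and y: "y \<in> space (messages_space \<mu> t)"
  shows "(\<integral>y. f y \<partial>((p \<bind> (\<lambda>x. K (Suc t) x y)) \<bind> (\<lambda>y'. return (messages_space \<mu> (Suc t)) (y(Suc t := y'))))) =
    (\<integral>y'. f (y(Suc t := y')) \<partial>(p \<bind> (\<lambda>x. K (Suc t) x y)))"
proof -
  have ap: "(\<lambda>y'. y(Suc t := y')) \<in> \<mu> \<rightarrow>\<^sub>M messages_space \<mu> (Suc t)"
    using measurable_compose[OF measurable_Pair1'[OF y] measurable_append_message] by simp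
  have m: "p \<bind> (\<lambda>x. K (Suc t) x y) \<in> space (prob_algebra \<mu>)"
    using measurable_space[OF measurable_message_law[OF t p] y] .
  have "(\<integral>y. f y \<partial>((p \<bind> (\<lambda>x. K (Suc t) x y)) \<bind> (\<lambda>y'. return (messages_space \<mu> (Suc t)) (y(Suc t := y'))))) =
      (\<integral>y'. (\<integral>z. f z \<partial>return (messages_space \<mu> (Suc t)) (y(Suc t := y'))) \<partial>(p \<bind> (\<lambda>x. K (Suc t) x y)))"
    by (rule integral_bind_prob_algebra[OF m measurable_compose[OF ap measurable_return_prob_space] f c])
  also have "\<dots> = (\<integral>y'. f (y(Suc t := y')) \<partial>(p \<bind> (\<lambda>x. K (Suc t) x y)))"
  proof (rule Bochner_Integration.integral_cong[OF refl])
    fix y' assume "y' \<in> space (p \<bind> (\<lambda>x. K (Suc t) x y))"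
    then have "y' \<in> space \<mu>"
      using m sets_eq_imp_space_eq[of "p \<bind> (\<lambda>x. K (Suc t) x y)" \<mu>] by (simp add: space_prob_algebra)
    then have "y(Suc t := y') \<in> space (messages_space \<mu> (Suc t))"
      by (rule measurable_space[OF ap])
    then show "(\<integral>z. f z \<partial>return (messages_space \<mu> (Suc t)) (y(Suc t := y'))) = f (y(Suc t := y'))"
      by (rule integral_return[OF _ f])
  qed
  finally show ?thesis .
qed

text \<open>Integrating out the last message turns a test function of \<open>Suc t\<close> messages
  into one of \<open>t\<close> messages; this drives the induction over rounds. The new test
  function is measurable because on the space it agrees with the integral against the append law,
  which is a measurable kernel.\<close>

lemma
  fixes f :: "(nat \<Rightarrow> 'y) \<Rightarrow> real"
  assumes t: "Suc t \<le> n" and p: "p \<in> space (prob_algebra X)"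
    and f: "f \<in> borel_measurable (messages_space \<mu> (Suc t))"
    and c: "\<And>y. y \<in> space (messages_space \<mu> (Suc t)) \<Longrightarrow> \<bar>f y\<bar> \<le> c"
  shows integral_round_law_Suc: "(\<integral>y. f y \<partial>round_law \<mu> K p (Suc t)) =
      (\<integral>y. (\<integral>y'. f (y(Suc t := y')) \<partial>(p \<bind> (\<lambda>x. K (Suc t) x y))) \<partial>round_law \<mu> K p t)"
    and measurable_integral_message_law:
      "(\<lambda>y. \<integral>y'. f (y(Suc t := y')) \<partial>(p \<bind> (\<lambda>x. K (Suc t) x y))) \<in> borel_measurable (messages_space \<mu> t)"
proof -
  note inner = integral_append_law[OF t p f c]
  have L: "round_law \<mu> K p t \<in> space (prob_algebra (messages_space \<mu> t))"
    using t by (intro round_law_in_prob_algebra p) auto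
  then have "space (round_law \<mu> K p t) = space (messages_space \<mu> t)"
    by (intro sets_eq_imp_space_eq) (simp add: space_prob_algebra)
  then show "(\<integral>y. f y \<partial>round_law \<mu> K p (Suc t)) =
      (\<integral>y. (\<integral>y'. f (y(Suc t := y')) \<partial>(p \<bind> (\<lambda>x. K (Suc t) x y))) \<partial>round_law \<mu> K p t)"
    unfolding round_law.simps
    by (intro trans[OF integral_bind_prob_algebra[OF L measurable_append_law[OF t p] f c]]
        Bochner_Integration.integral_cong[OF refl] inner) auto
  show "(\<lambda>y. \<integral>y'. f (y(Suc t := y')) \<partial>(p \<bind> (\<lambda>x. K (Suc t) x y))) \<in> borel_measurable (messages_space \<mu> t)"
    using measurable_compose[OF measurable_prob_algebraD[OF measurable_append_law[OF t p]]
        integral_measurable_subprob_algebra[OF f]]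
    by (rule measurable_cong[THEN iffD1, rotated]) (rule inner)
qed

end

section \<open>Accumulating the information of the rounds\<close>

locale information_rounds = round_kernels +
  fixes J :: "'i set" and p :: "'x measure" and q :: "'i \<Rightarrow> 'x measure"
    and a :: "'i \<Rightarrow> real" and \<phi> :: "'i \<Rightarrow> 'x \<Rightarrow> real"
    and \<W> :: "nat \<Rightarrow> ('x \<Rightarrow> 'y measure) set" and d :: "nat \<Rightarrow> real"
  assumes J: "finite J" and mu: "sigma_finite_measure \<mu>"
    and p: "prob_space p" "sets p = sets X"
    and q: "i \<in> J \<Longrightarrow> prob_space (q i)" "i \<in> J \<Longrightarrow> sets (q i) = sets X"
      "i \<in> J \<Longrightarrow> absolutely_continuous p (q i)"
    and \<phi>: "i \<in> J \<Longrightarrow> \<phi> i \<in> borel_measurable X"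
    and RN: "i \<in> J \<Longrightarrow> AE x in p. enn2real (RN_deriv p (q i) x) = 1 + a i * \<phi> i x"
    and channels: "t \<in> {1..n} \<Longrightarrow> \<W> t \<subseteq> channels X \<mu>"
    and K_channel: "t \<in> {1..n} \<Longrightarrow> y \<in> space (messages_space \<mu> (t - 1)) \<Longrightarrow>
      \<exists>V\<in>\<W> t. \<forall>x\<in>space X. K t x y = V x"
    and d: "t \<in> {1..n} \<Longrightarrow> V \<in> \<W> t \<Longrightarrow>
      (\<Sum>i\<in>J. ennreal ((a i)\<^sup>2) * (\<integral>\<^sup>+ y. ennreal ((\<integral>x. \<phi> i x * channel_density X \<mu> V x y \<partial>p)\<^sup>2
        / (\<integral>x. channel_density X \<mu> V x y \<partial>p)) \<partial>\<mu>)) \<le> ennreal (d t)"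
    and d_nonneg: "t \<in> {1..n} \<Longrightarrow> 0 \<le> d t"
begin

lemma p_prob: "p \<in> space (prob_algebra X)" and q_prob: "i \<in> J \<Longrightarrow> q i \<in> space (prob_algebra X)"
  using p q by (auto simp: space_prob_algebra)

text \<open>For a fixed past \<open>y\<close> the same channel \<open>V\<close> acts on
  \<open>p\<close> and on all the \<open>q i\<close>. Each alternative is charged its own share
  \<open>I i\<close>, and only the total is compared with \<open>d (Suc t)\<close>; this keeps the
  sum over \<open>i\<close> inside the supremum over channels. The shares are finite because their
  sum is, so they may be converted to reals.\<close>

lemma sum_message_functional_le:
  assumes t: "Suc t \<le> n" and y: "y \<in> space (messages_space \<mu> t)"
    and g: "\<And>i. i \<in> J \<Longrightarrow> g i \<in> borel_measurable \<mu>"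
      "\<And>i y. i \<in> J \<Longrightarrow> y \<in> space \<mu> \<Longrightarrow> \<bar>g i y\<bar> \<le> (1::real)"
  defines "G \<equiv> \<lambda>i. \<integral>y'. g i y' \<partial>(q i \<bind> (\<lambda>x. K (Suc t) x y))"
  shows "(\<Sum>i\<in>J. \<integral>y'. g i y' - (g i y')\<^sup>2 / 2 \<partial>(p \<bind> (\<lambda>x. K (Suc t) x y)))
    \<le> (\<Sum>i\<in>J. G i - (G i)\<^sup>2 / 2) + 9 / 2 * d (Suc t)"
proof -
  obtain V where V: "V \<in> \<W> (Suc t)" and KV: "\<And>x. x \<in> space X \<Longrightarrow> K (Suc t) x y = V x"
    using K_channel[of "Suc t" y] t y by auto
  have Vc: "V \<in> channels X \<mu>" using channels[of "Suc t"] t V by auto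
  then have Vm: "V \<in> X \<rightarrow>\<^sub>M prob_algebra \<mu>" by (simp add: channels_def)
  have bind_eq: "r \<bind> (\<lambda>x. K (Suc t) x y) = r \<bind> V" if "sets r = sets X" for r
    using KV sets_eq_imp_space_eq[OF that] by (intro bind_cong) auto
  define I where "I i = ennreal ((a i)\<^sup>2) * (\<integral>\<^sup>+ y. ennreal ((\<integral>x. \<phi> i x * channel_density X \<mu> V x y \<partial>p)\<^sup>2
        / (\<integral>x. channel_density X \<mu> V x y \<partial>p)) \<partial>\<mu>)" for i
  have sum_I: "sum I J \<le> ennreal (d (Suc t))"
    using d[of "Suc t" V] t V by (simp add: I_def)
  then have "sum I J < top" by (rule le_less_trans) simp
  then have fin: "I i < top" if "i \<in> J" for i
    using that J by (auto simp: less_top)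
  have "(\<integral>y'. g i y' - (g i y')\<^sup>2 / 2 \<partial>(p \<bind> (\<lambda>x. K (Suc t) x y)))
      \<le> G i - (G i)\<^sup>2 / 2 + 9 / 2 * enn2real (I i)" if i: "i \<in> J" for i
    unfolding G_def bind_eq[OF p(2)] bind_eq[OF q(2)[OF i]]
    using fin[OF i]
    by (intro message_functional_le[OF mu p q[OF i] \<phi>[OF i] RN[OF i] Vm channel_density[OF Vc] g[OF i]])
       (auto simp: I_def)
  then have "(\<Sum>i\<in>J. \<integral>y'. g i y' - (g i y')\<^sup>2 / 2 \<partial>(p \<bind> (\<lambda>x. K (Suc t) x y)))
      \<le> (\<Sum>i\<in>J. G i - (G i)\<^sup>2 / 2 + 9 / 2 * enn2real (I i))"
    by (rule sum_mono)
  also have "\<dots> = (\<Sum>i\<in>J. G i - (G i)\<^sup>2 / 2) + 9 / 2 * enn2real (sum I J)"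
    using fin by (simp add: sum.distrib sum_distrib_left enn2real_sum)
  also have "enn2real (sum I J) \<le> d (Suc t)"
    using sum_I d_nonneg[of "Suc t"] t by (intro enn2real_leI) auto
  finally show ?thesis by simp
qed

text \<open>Removing the last message replaces the test functions, so the induction must run over
  all bounded families \<open>g\<close>. In the p-parts the past always has the law
  \<open>round_law \<mu> K p t\<close>, whatever \<open>i\<close> is; the sum over \<open>i\<close>
  therefore moves under one integral, and the one-message bound is applied there pointwise.\<close>

lemma messages_functional_le:
  assumes "t \<le> n"
    and "\<And>i. i \<in> J \<Longrightarrow> g i \<in> borel_measurable (messages_space \<mu> t)"
    and "\<And>i y. i \<in> J \<Longrightarrow> y \<in> space (messages_space \<mu> t) \<Longrightarrow> \<bar>g i y\<bar> \<le> (1::real)"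
  shows "(\<Sum>i\<in>J. (\<integral>y. g i y - (g i y)\<^sup>2 / 2 \<partial>round_law \<mu> K p t)
      - (\<integral>y. g i y + (g i y)\<^sup>2 / 2 \<partial>round_law \<mu> K (q i) t)) \<le> 9 / 2 * (\<Sum>s=1..t. d s)"
  using assms
proof (induction t arbitrary: g)
  case 0
  have [simp]: "(\<lambda>_. undefined) \<in> space (messages_space \<mu> 0)" by (simp add: space_PiM)
  \<comment> \<open>Without messages both laws are the same point mass, and the difference is minus
    the square of \<open>g i\<close> at that point.\<close>
  have "(\<integral>y. g i y - (g i y)\<^sup>2 / 2 \<partial>round_law \<mu> K p 0) - (\<integral>y. g i y + (g i y)\<^sup>2 / 2 \<partial>round_law \<mu> K (q i) 0) \<le> 0"
    if "i \<in> J" for i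
    using 0(2)[OF that] by (simp add: integral_return del: atLeastatMost_empty atLeastatMost_empty_iff2)
  then show ?case by (simp add: sum_nonpos)
next
  case (Suc t)
  note t = \<open>Suc t \<le> n\<close> and g = Suc.prems(2,3)
  let ?N = "\<lambda>r y. r \<bind> (\<lambda>x. K (Suc t) x y)"
  \<comment> \<open>The mean is taken under \<open>q i\<close>, as Jensen's inequality requires in
    the q-part. The price for the mismatch is paid in the p-part.\<close>
  define G where "G i y = (\<integral>y'. g i (y(Suc t := y')) \<partial>?N (q i) y)" for i y
  have N: "?N r y \<in> space (prob_algebra \<mu>)"
    if "r \<in> space (prob_algebra X)" "y \<in> space (messages_space \<mu> t)" for r y
    using measurable_space[OF measurable_message_law[OF t that(1)] that(2)] .
  have ap: "(\<lambda>y'. y(Suc t := y')) \<in> \<mu> \<rightarrow>\<^sub>M messages_space \<mu> (Suc t)" if y: "y \<in> space (messages_space \<mu> t)" for y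
    using measurable_compose[OF measurable_Pair1'[OF y] measurable_append_message] by simp
  have gy: "(\<lambda>y'. g i (y(Suc t := y'))) \<in> borel_measurable \<mu>"
      "\<And>y'. y' \<in> space \<mu> \<Longrightarrow> \<bar>g i (y(Suc t := y'))\<bar> \<le> 1"
    if "i \<in> J" "y \<in> space (messages_space \<mu> t)" for i y
    by (rule measurable_compose[OF ap[OF that(2)] g(1)[OF that(1)]])
       (rule g(2)[OF that(1) measurable_space[OF ap[OF that(2)]]])
  have Gm: "G i \<in> borel_measurable (messages_space \<mu> t)" if "i \<in> J" for i
    unfolding G_def by (rule measurable_integral_message_law[OF t q_prob[OF that] g[OF that]])
  have G1: "\<bar>G i y\<bar> \<le> 1" if "i \<in> J" "y \<in> space (messages_space \<mu> t)" for i y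
    unfolding G_def by (rule abs_integral_le_prob_algebra[OF N[OF q_prob[OF that(1)] that(2)] gy[OF that]])
  have sq: "\<bar>u - u\<^sup>2 / 2\<bar> \<le> 2" "\<bar>u + u\<^sup>2 / 2\<bar> \<le> 2" if "\<bar>u\<bar> \<le> 1" for u :: real
    using that abs_square_le_1[of u] zero_le_power2[of u] unfolding abs_le_iff by linarith+
  have gq: "(\<lambda>y. g i y - (g i y)\<^sup>2 / 2) \<in> borel_measurable (messages_space \<mu> (Suc t))"
      "(\<lambda>y. g i y + (g i y)\<^sup>2 / 2) \<in> borel_measurable (messages_space \<mu> (Suc t))" if "i \<in> J" for i
    using g(1)[OF that] by measurable
  have gq2: "\<bar>g i y - (g i y)\<^sup>2 / 2\<bar> \<le> 2" "\<bar>g i y + (g i y)\<^sup>2 / 2\<bar> \<le> 2"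
    if "i \<in> J" "y \<in> space (messages_space \<mu> (Suc t))" for i y
    using sq[OF g(2)[OF that]] by auto
  have Gq: "(\<lambda>y. G i y - (G i y)\<^sup>2 / 2) \<in> borel_measurable (messages_space \<mu> t)"
      "(\<lambda>y. G i y + (G i y)\<^sup>2 / 2) \<in> borel_measurable (messages_space \<mu> t)" if "i \<in> J" for i
    using Gm[OF that] by measurable
  have Gq2: "\<bar>G i y - (G i y)\<^sup>2 / 2\<bar> \<le> 2" "\<bar>G i y + (G i y)\<^sup>2 / 2\<bar> \<le> 2"
    if "i \<in> J" "y \<in> space (messages_space \<mu> t)" for i y
    using sq[OF G1[OF that]] by auto
  have L: "round_law \<mu> K r t \<in> space (prob_algebra (messages_space \<mu> t))" if "r \<in> space (prob_algebra X)" for r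
    using t by (intro round_law_in_prob_algebra that) auto
  have space_L: "space (round_law \<mu> K r t) = space (messages_space \<mu> t)" if "r \<in> space (prob_algebra X)" for r
    using L[OF that] by (intro sets_eq_imp_space_eq) (simp add: space_prob_algebra)
  interpret L: prob_space "round_law \<mu> K p t"
    using L[OF p_prob] by (simp add: space_prob_algebra)
  define H where "H i y = (\<integral>y'. g i (y(Suc t := y')) - (g i (y(Suc t := y')))\<^sup>2 / 2 \<partial>?N p y)" for i y
  have H: "integrable (round_law \<mu> K p t) (H i)" if i: "i \<in> J" for i
    unfolding H_def
  proof (rule integrable_bounded_prob_algebra[OF L[OF p_prob] measurable_integral_message_law[OF t p_prob gq(1)[OF i] gq2(1)[OF i]]])
    fix y assume y: "y \<in> space (messages_space \<mu> t)"
    show "\<bar>\<integral>y'. g i (y(Suc t := y')) - (g i (y(Suc t := y')))\<^sup>2 / 2 \<partial>?N p y\<bar> \<le> 2"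
      using sq(1)[OF gy(2)[OF i y]]
      by (intro abs_integral_le_prob_algebra[OF N[OF p_prob y]] borel_measurable_diff borel_measurable_divide
          borel_measurable_power gy(1)[OF i y]) auto
  qed
  have GL: "integrable (round_law \<mu> K p t) (\<lambda>y. G i y - (G i y)\<^sup>2 / 2)" if "i \<in> J" for i
    by (rule integrable_bounded_prob_algebra[OF L[OF p_prob] Gq(1)[OF that] Gq2(1)[OF that]])
  have "(\<Sum>i\<in>J. \<integral>y. g i y - (g i y)\<^sup>2 / 2 \<partial>round_law \<mu> K p (Suc t)) = (\<Sum>i\<in>J. \<integral>y. H i y \<partial>round_law \<mu> K p t)"
    unfolding H_def by (intro sum.cong refl integral_round_law_Suc[OF t p_prob gq(1) gq2(1)])
  also have "\<dots> = (\<integral>y. (\<Sum>i\<in>J. H i y) \<partial>round_law \<mu> K p t)"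
    using H by simp
  also have "\<dots> \<le> (\<integral>y. (\<Sum>i\<in>J. G i y - (G i y)\<^sup>2 / 2) + 9 / 2 * d (Suc t) \<partial>round_law \<mu> K p t)"
  proof (rule integral_mono)
    fix y assume "y \<in> space (round_law \<mu> K p t)"
    then have y: "y \<in> space (messages_space \<mu> t)" using space_L[OF p_prob] by simp
    show "(\<Sum>i\<in>J. H i y) \<le> (\<Sum>i\<in>J. G i y - (G i y)\<^sup>2 / 2) + 9 / 2 * d (Suc t)"
      unfolding H_def G_def using sum_message_functional_le[OF t y gy[OF _ y]] .
  qed (use H GL in auto)
  also have "\<dots> = (\<Sum>i\<in>J. \<integral>y. G i y - (G i y)\<^sup>2 / 2 \<partial>round_law \<mu> K p t) + 9 / 2 * d (Suc t)"
    using GL by (simp add: L.prob_space)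
  finally have 1: "(\<Sum>i\<in>J. \<integral>y. g i y - (g i y)\<^sup>2 / 2 \<partial>round_law \<mu> K p (Suc t))
    \<le> (\<Sum>i\<in>J. \<integral>y. G i y - (G i y)\<^sup>2 / 2 \<partial>round_law \<mu> K p t) + 9 / 2 * d (Suc t)" .
  \<comment> \<open>Jensen's inequality in the form of a nonnegative variance. The plus sign of the
    square in the q-part makes the replacement of \<open>g\<close> by \<open>G\<close> go in the
    right direction, so this part costs nothing.\<close>
  have "(\<integral>y. G i y + (G i y)\<^sup>2 / 2 \<partial>round_law \<mu> K (q i) t) \<le> (\<integral>y. g i y + (g i y)\<^sup>2 / 2 \<partial>round_law \<mu> K (q i) (Suc t))"
    if i: "i \<in> J" for i
  proof (rule ord_le_eq_trans[OF integral_mono integral_round_law_Suc[OF t q_prob[OF i] gq(2)[OF i] gq2(2)[OF i], symmetric]])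
    show "integrable (round_law \<mu> K (q i) t) (\<lambda>y. G i y + (G i y)\<^sup>2 / 2)"
      by (rule integrable_bounded_prob_algebra[OF L[OF q_prob[OF i]] Gq(2)[OF i] Gq2(2)[OF i]])
    show "integrable (round_law \<mu> K (q i) t) (\<lambda>y. \<integral>y'. g i (y(Suc t := y')) + (g i (y(Suc t := y')))\<^sup>2 / 2 \<partial>?N (q i) y)"
    proof (rule integrable_bounded_prob_algebra[OF L[OF q_prob[OF i]]
          measurable_integral_message_law[OF t q_prob[OF i] gq(2)[OF i] gq2(2)[OF i]]])
      fix y assume y: "y \<in> space (messages_space \<mu> t)"
      show "\<bar>\<integral>y'. g i (y(Suc t := y')) + (g i (y(Suc t := y')))\<^sup>2 / 2 \<partial>?N (q i) y\<bar> \<le> 2"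
        using sq(2)[OF gy(2)[OF i y]]
        by (intro abs_integral_le_prob_algebra[OF N[OF q_prob[OF i] y]] borel_measurable_add borel_measurable_divide
            borel_measurable_power gy(1)[OF i y]) auto
    qed
  next
    fix y assume "y \<in> space (round_law \<mu> K (q i) t)"
    then have y: "y \<in> space (messages_space \<mu> t)" using space_L[OF q_prob[OF i]] by simp
    interpret N: prob_space "?N (q i) y"
      using N[OF q_prob[OF i] y] by (simp add: space_prob_algebra)
    have i1: "integrable (?N (q i) y) (\<lambda>y'. g i (y(Suc t := y')))"
      by (rule integrable_bounded_prob_algebra[OF N[OF q_prob[OF i] y] gy[OF i y]])
    have i2: "integrable (?N (q i) y) (\<lambda>y'. (g i (y(Suc t := y')))\<^sup>2)"
      using gy[OF i y]
      by (intro integrable_bounded_prob_algebra[OF N[OF q_prob[OF i] y], where c = 1] borel_measurable_power)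
         (auto simp: abs_square_le_1)
    have "(G i y)\<^sup>2 \<le> (\<integral>y'. (g i (y(Suc t := y')))\<^sup>2 \<partial>?N (q i) y)"
      using N.variance_eq[OF i1 i2] N.variance_positive[of "\<lambda>y'. g i (y(Suc t := y'))"] by (simp add: G_def)
    then show "G i y + (G i y)\<^sup>2 / 2 \<le> (\<integral>y'. g i (y(Suc t := y')) + (g i (y(Suc t := y')))\<^sup>2 / 2 \<partial>?N (q i) y)"
      using i1 i2 by (simp add: G_def)
  qed
  then have "(\<Sum>i\<in>J. \<integral>y. G i y + (G i y)\<^sup>2 / 2 \<partial>round_law \<mu> K (q i) t)
    \<le> (\<Sum>i\<in>J. \<integral>y. g i y + (g i y)\<^sup>2 / 2 \<partial>round_law \<mu> K (q i) (Suc t))"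
    by (rule sum_mono)
  moreover have "(\<Sum>i\<in>J. (\<integral>y. G i y - (G i y)\<^sup>2 / 2 \<partial>round_law \<mu> K p t)
      - (\<integral>y. G i y + (G i y)\<^sup>2 / 2 \<partial>round_law \<mu> K (q i) t)) \<le> 9 / 2 * (\<Sum>s=1..t. d s)"
    using t by (intro Suc.IH Gm G1) auto
  ultimately show ?case
    using 1 by (simp add: sum_subtractf)
qed

lemma squared_distance_bound:
  assumes A: "\<And>i. i \<in> J \<Longrightarrow> A i \<in> sets (messages_space \<mu> n)"
  shows "(\<Sum>i\<in>J. (measure (round_law \<mu> K p n) (A i) - measure (round_law \<mu> K (q i) n) (A i))\<^sup>2)
    \<le> 9 / 2 * (\<Sum>s=1..n. d s)"
proof -
  define c where "c i = measure (round_law \<mu> K p n) (A i) - measure (round_law \<mu> K (q i) n) (A i)" for i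
  \<comment> \<open>\<open>g i\<close> takes only the values \<open>c i\<close> and
    \<open>- c i\<close>, so its square is constant. For a general scale c, with x the difference of
    the two probabilities of \<open>A i\<close>, the functional equals 2 c x - c^2. It is largest at
    c = x, with value x^2, and this is the choice made in \<open>c\<close>.\<close>
  define g where "g i y = c i * (2 * indicator (A i) y - 1)" for i y
  have L: "prob_space (round_law \<mu> K r n)" "sets (round_law \<mu> K r n) = sets (messages_space \<mu> n)"
    if "r \<in> space (prob_algebra X)" for r
    using round_law_in_prob_algebra[OF order_refl that] by (auto simp: space_prob_algebra)
  have c1: "\<bar>c i\<bar> \<le> 1" if "i \<in> J" for i
  proof -
    interpret P: prob_space "round_law \<mu> K p n" by (rule L[OF p_prob])
    interpret Q: prob_space "round_law \<mu> K (q i) n" by (rule L[OF q_prob[OF that]])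
    show ?thesis
      using P.prob_le_1[of "A i"] Q.prob_le_1[of "A i"] measure_nonneg[of "round_law \<mu> K p n" "A i"]
        measure_nonneg[of "round_law \<mu> K (q i) n" "A i"] unfolding c_def by linarith
  qed
  have g2: "(g i y)\<^sup>2 = (c i)\<^sup>2" for i y
    by (simp add: g_def power_mult_distrib split: split_indicator)
  \<comment> \<open>One computation for both signs: s = -1 for the p-part, s = 1 for the
    q-parts.\<close>
  have int: "(\<integral>y. g i y + s * (g i y)\<^sup>2 / 2 \<partial>round_law \<mu> K r n)
      = c i * (2 * measure (round_law \<mu> K r n) (A i) - 1) + s * (c i)\<^sup>2 / 2"
    if "i \<in> J" and r: "r \<in> space (prob_algebra X)" for i r s
  proof -
    interpret P: prob_space "round_law \<mu> K r n" by (rule L[OF r])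
    have "A i \<in> sets (round_law \<mu> K r n)" using A[OF that(1)] L(2)[OF r] by simp
    then show ?thesis
      unfolding g2 by (simp add: g_def P.prob_space P.emeasure_eq_measure)
  qed
  have "(\<Sum>i\<in>J. (\<integral>y. g i y - (g i y)\<^sup>2 / 2 \<partial>round_law \<mu> K p n)
      - (\<integral>y. g i y + (g i y)\<^sup>2 / 2 \<partial>round_law \<mu> K (q i) n)) \<le> 9 / 2 * (\<Sum>s=1..n. d s)"
  proof (rule messages_functional_le[OF order_refl])
    fix i y assume i: "i \<in> J"
    show "\<bar>g i y\<bar> \<le> 1"
      using c1[OF i] by (simp add: g_def split: split_indicator)
    show "g i \<in> borel_measurable (messages_space \<mu> n)"
      unfolding g_def using A[OF i] by measurable
  qed
  moreover have "(\<integral>y. g i y - (g i y)\<^sup>2 / 2 \<partial>round_law \<mu> K p n)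
      - (\<integral>y. g i y + (g i y)\<^sup>2 / 2 \<partial>round_law \<mu> K (q i) n) = (c i)\<^sup>2" if "i \<in> J" for i
  proof -
    have "(\<integral>y. g i y - (g i y)\<^sup>2 / 2 \<partial>round_law \<mu> K p n)
        = c i * (2 * measure (round_law \<mu> K p n) (A i) - 1) - (c i)\<^sup>2 / 2"
      using int[OF that p_prob, of "-1"] by simp
    moreover have "(\<integral>y. g i y + (g i y)\<^sup>2 / 2 \<partial>round_law \<mu> K (q i) n)
        = c i * (2 * measure (round_law \<mu> K (q i) n) (A i) - 1) + (c i)\<^sup>2 / 2"
      using int[OF that q_prob[OF that], of 1] by simp
    ultimately have "(\<integral>y. g i y - (g i y)\<^sup>2 / 2 \<partial>round_law \<mu> K p n)
        - (\<integral>y. g i y + (g i y)\<^sup>2 / 2 \<partial>round_law \<mu> K (q i) n)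
      = 2 * c i * (measure (round_law \<mu> K p n) (A i) - measure (round_law \<mu> K (q i) n) (A i)) - (c i)\<^sup>2"
      by (simp add: algebra_simps)
    then show ?thesis by (simp add: power2_eq_square flip: c_def)
  qed
  ultimately show ?thesis by (simp add: c_def)
qed

end

section \<open>Averaging over the randomness\<close>

lemma PiM_in_prob_algebra:
  assumes "p \<in> space (prob_algebra X)"
  shows "(\<Pi>\<^sub>M t\<in>I. p) \<in> space (prob_algebra (\<Pi>\<^sub>M t\<in>I. X))"
  using assms by (auto simp: space_prob_algebra intro!: prob_space_PiM sets_PiM_cong)

text \<open>Causality: later inputs do not influence earlier messages. This frees the last
  coordinate of the input vector when it is split off from the product measure.\<close>

lemma messages_given_cong:
  "(\<And>s. s \<in> {1..t} \<Longrightarrow> x s = x' s) \<Longrightarrow> messages_given \<mu> W u v x t = messages_given \<mu> W u v x' t"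
  by (induction t) auto

section \<open>Measurability in the randomness and the inputs, and integrating out the
  inputs\<close>

locale protocol =
  fixes n :: nat and X :: "'x measure" and \<mu> :: "'y measure" and \<W> :: "nat \<Rightarrow> ('x \<Rightarrow> 'y measure) set"
    and Q :: "'u measure" and R :: "nat \<Rightarrow> 'v measure"
    and W :: "nat \<Rightarrow> 'u \<Rightarrow> 'v \<Rightarrow> 'x \<Rightarrow> (nat \<Rightarrow> 'y) \<Rightarrow> 'y measure"
  assumes protocol: "seq_interactive_protocol n X \<mu> \<W> Q R W"
begin

abbreviation "RR \<equiv> \<Pi>\<^sub>M t\<in>{1..n}. R t"
abbreviation "K u v \<equiv> \<lambda>t x y. W t u (v t) x y"

lemma Q: "prob_space Q" and R: "t \<in> {1..n} \<Longrightarrow> prob_space (R t)"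
  and W: "t \<in> {1..n} \<Longrightarrow>
    (\<lambda>(u, v, x, y). W t u v x y) \<in> Q \<Otimes>\<^sub>M R t \<Otimes>\<^sub>M X \<Otimes>\<^sub>M messages_space \<mu> (t - 1) \<rightarrow>\<^sub>M prob_algebra \<mu>"
  using protocol by (auto simp: seq_interactive_protocol_def)

lemma RR: "prob_space RR"
  using R by (intro prob_space_PiM)

lemma K_kernels:
  assumes "u \<in> space Q" "v \<in> space RR"
  shows "round_kernels n X \<mu> (K u v)"
proof
  fix t assume t: "t \<in> {1..n}"
  have "v t \<in> space (R t)" using assms(2) t by (auto simp: space_PiM)
  then have m: "(\<lambda>(x, y). (u, v t, x, y)) \<in> X \<Otimes>\<^sub>M messages_space \<mu> (t - 1)
      \<rightarrow>\<^sub>M Q \<Otimes>\<^sub>M R t \<Otimes>\<^sub>M X \<Otimes>\<^sub>M messages_space \<mu> (t - 1)"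
    using assms(1) by measurable
  show "(\<lambda>(x, y). W t u (v t) x y) \<in> X \<Otimes>\<^sub>M messages_space \<mu> (t - 1) \<rightarrow>\<^sub>M prob_algebra \<mu>"
    using measurable_compose[OF m W[OF t]] by (simp add: case_prod_beta')
qed

lemma measurable_append:
  assumes t: "Suc t \<le> n"
  shows "(\<lambda>(u, v, x, y). W (Suc t) u v x y \<bind> (\<lambda>y'. return (messages_space \<mu> (Suc t)) (y(Suc t := y'))))
    \<in> Q \<Otimes>\<^sub>M R (Suc t) \<Otimes>\<^sub>M X \<Otimes>\<^sub>M messages_space \<mu> t \<rightarrow>\<^sub>M prob_algebra (messages_space \<mu> (Suc t))"
proof -
  let ?T = "Q \<Otimes>\<^sub>M R (Suc t) \<Otimes>\<^sub>M X \<Otimes>\<^sub>M messages_space \<mu> t"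
  have m: "(\<lambda>q. ((snd (snd (snd (fst q)))), snd q)) \<in> ?T \<Otimes>\<^sub>M \<mu> \<rightarrow>\<^sub>M messages_space \<mu> t \<Otimes>\<^sub>M \<mu>"
    by measurable
  have "(\<lambda>q. W (Suc t) (fst q) (fst (snd q)) (fst (snd (snd q))) (snd (snd (snd q))) \<bind>
      (\<lambda>y'. return (messages_space \<mu> (Suc t)) ((snd (snd (snd q)))(Suc t := y'))))
    \<in> ?T \<rightarrow>\<^sub>M prob_algebra (messages_space \<mu> (Suc t))"
  proof (rule measurable_bind_prob_space2)
    show "(\<lambda>q. W (Suc t) (fst q) (fst (snd q)) (fst (snd (snd q))) (snd (snd (snd q)))) \<in> ?T \<rightarrow>\<^sub>M prob_algebra \<mu>"
      using W[of "Suc t"] t by (simp add: case_prod_beta')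
    show "(\<lambda>(q, y'). return (messages_space \<mu> (Suc t)) ((snd (snd (snd q)))(Suc t := y')))
        \<in> ?T \<Otimes>\<^sub>M \<mu> \<rightarrow>\<^sub>M prob_algebra (messages_space \<mu> (Suc t))"
      using measurable_compose[OF measurable_compose[OF m measurable_append_message] measurable_return_prob_space]
      by (simp add: case_prod_beta')
  qed
  then show ?thesis by (simp add: case_prod_beta')
qed

text \<open>The index set \<open>J\<close> may exceed \<open>{1..t}\<close>, so that the law after
  \<open>t\<close> rounds can also be viewed as a function of an input vector that already contains
  later inputs. The recursion needs this, since its step reads one more input.\<close>

lemma measurable_messages_given:
  assumes "t \<le> n" "{1..t} \<subseteq> J"
  shows "(\<lambda>(u, v, x). messages_given \<mu> W u v x t)
    \<in> Q \<Otimes>\<^sub>M RR \<Otimes>\<^sub>M (\<Pi>\<^sub>M t\<in>J. X) \<rightarrow>\<^sub>M prob_algebra (messages_space \<mu> t)"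
  using assms
proof (induction t)
  case 0
  have "return (messages_space \<mu> 0) (\<lambda>_. undefined) \<in> space (prob_algebra (messages_space \<mu> 0))"
    by (auto simp: space_prob_algebra space_PiM intro!: prob_space_return)
  then show ?case by simp
next
  case (Suc t)
  let ?T = "Q \<Otimes>\<^sub>M RR \<Otimes>\<^sub>M (\<Pi>\<^sub>M t\<in>J. X)"
  have IH: "(\<lambda>q. messages_given \<mu> W (fst q) (fst (snd q)) (snd (snd q)) t)
      \<in> ?T \<rightarrow>\<^sub>M prob_algebra (messages_space \<mu> t)"
    using Suc.IH[OF Suc_leD[OF Suc.prems(1)] subset_trans[OF _ Suc.prems(2)]] by (simp add: case_prod_beta')
  have J: "Suc t \<in> {1..n}" "Suc t \<in> J" using Suc.prems by auto
  have m: "(\<lambda>(q, y). (fst q, (fst (snd q)) (Suc t), (snd (snd q)) (Suc t), y))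
      \<in> ?T \<Otimes>\<^sub>M messages_space \<mu> t \<rightarrow>\<^sub>M Q \<Otimes>\<^sub>M R (Suc t) \<Otimes>\<^sub>M X \<Otimes>\<^sub>M messages_space \<mu> t"
    using J by measurable
  have "(\<lambda>q. messages_given \<mu> W (fst q) (fst (snd q)) (snd (snd q)) t \<bind> (\<lambda>y.
       W (Suc t) (fst q) (fst (snd q) (Suc t)) (snd (snd q) (Suc t)) y \<bind> (\<lambda>y'.
         return (messages_space \<mu> (Suc t)) (y(Suc t := y'))))) \<in> ?T \<rightarrow>\<^sub>M prob_algebra (messages_space \<mu> (Suc t))"
    using measurable_compose[OF m measurable_append] Suc.prems
    by (intro measurable_bind_prob_space2[OF IH]) (simp add: case_prod_beta')
  then show ?case by (simp add: case_prod_beta')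
qed

text \<open>The inputs are independent and each is read once, so averaging over all of them at the
  end agrees with averaging round by round. In the step, the last input is split off, moved past the
  first \<open>t\<close> messages by Tonelli's theorem, and absorbed into a new test function, which
  is why \<open>f\<close> is arbitrary in the induction. Nonnegative functions make every exchange
  unconditional.\<close>

lemma nn_integral_messages_given:
  assumes p: "p \<in> space (prob_algebra X)" and u: "u \<in> space Q" and v: "v \<in> space RR"
    and "t \<le> n" and "f \<in> borel_measurable (messages_space \<mu> t)"
  shows "(\<integral>\<^sup>+ x. (\<integral>\<^sup>+ y. f y \<partial>messages_given \<mu> W u v x t) \<partial>(\<Pi>\<^sub>M s\<in>{1..t}. p))
    = (\<integral>\<^sup>+ y. f y \<partial>round_law \<mu> (K u v) p t)"
  using assms(4,5)
proof (induction t arbitrary: f)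
  case 0
  then show ?case by (simp add: PiM_empty nn_integral_count_space_finite)
next
  case (Suc t)
  note f = \<open>f \<in> borel_measurable (messages_space \<mu> (Suc t))\<close>
  interpret K: round_kernels n X \<mu> "K u v" by (rule K_kernels[OF u v])
  interpret p: prob_space p using p by (simp add: space_prob_algebra)
  have sets_p[measurable_cong]: "sets p = sets X" using p by (simp add: space_prob_algebra)
  interpret PP: product_sigma_finite "\<lambda>_. p" by standard
  define A where "A x y = W (Suc t) u (v (Suc t)) x y \<bind> (\<lambda>y'. return (messages_space \<mu> (Suc t)) (y(Suc t := y')))" for x y
  have vt: "v (Suc t) \<in> space (R (Suc t))" using v Suc.prems by (auto simp: space_PiM)
  have m: "(\<lambda>(x, y). (u, v (Suc t), x, y)) \<in> X \<Otimes>\<^sub>M messages_space \<mu> t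
      \<rightarrow>\<^sub>M Q \<Otimes>\<^sub>M R (Suc t) \<Otimes>\<^sub>M X \<Otimes>\<^sub>M messages_space \<mu> t"
    using u vt by measurable
  have A: "(\<lambda>(x, y). A x y) \<in> X \<Otimes>\<^sub>M messages_space \<mu> t \<rightarrow>\<^sub>M prob_algebra (messages_space \<mu> (Suc t))"
    using measurable_compose[OF m measurable_append] Suc.prems by (simp add: A_def case_prod_beta')
  have A': "(\<lambda>(x, y). A x y) \<in> X \<Otimes>\<^sub>M messages_space \<mu> t \<rightarrow>\<^sub>M subprob_algebra (messages_space \<mu> (Suc t))"
    by (rule measurable_prob_algebraD[OF A])
  \<comment> \<open>\<open>F x y\<close> is the mean of \<open>f\<close> once player
    \<open>Suc t\<close>, holding \<open>x\<close>, has answered the past \<open>y\<close>.\<close>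
  define F where "F x y = (\<integral>\<^sup>+ z. f z \<partial>A x y)" for x y
  have F[measurable]: "(\<lambda>(x, y). F x y) \<in> borel_measurable (X \<Otimes>\<^sub>M messages_space \<mu> t)"
    using measurable_compose[OF A' nn_integral_measurable_subprob_algebra[OF f]]
    by (simp add: F_def case_prod_beta')
  have mg: "messages_given \<mu> W u v x s \<in> space (prob_algebra (messages_space \<mu> s))"
    if "s \<le> n" "x \<in> space (\<Pi>\<^sub>M t\<in>{1..s}. X)" for s x
    using measurable_space[OF measurable_messages_given[OF that(1) order_refl], of "(u, v, x)"] u v that
    by (simp add: space_pair_measure)
  have mg': "messages_given \<mu> W u v x t \<in> space (prob_algebra (messages_space \<mu> t))"
    if "x \<in> space (\<Pi>\<^sub>M t\<in>{1..Suc t}. X)" for x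
    using measurable_space[OF measurable_messages_given[of t "{1..Suc t}"], of "(u, v, x)"] u v that Suc.prems
    by (simp add: space_pair_measure)
  have ins: "{1..Suc t} = insert (Suc t) {1..t}" by auto
  have space_p: "space (\<Pi>\<^sub>M t\<in>{1..s}. p) = space (\<Pi>\<^sub>M t\<in>{1..s}. X)" for s
    by (intro sets_eq_imp_space_eq sets_PiM_cong) (auto simp: sets_p)

  have 1: "(\<integral>\<^sup>+ y. f y \<partial>messages_given \<mu> W u v x (Suc t)) = (\<integral>\<^sup>+ y. F (x (Suc t)) y \<partial>messages_given \<mu> W u v x t)"
    if x: "x \<in> space (\<Pi>\<^sub>M s\<in>{1..Suc t}. X)" for x
  proof -
    have [measurable_cong]: "sets (messages_given \<mu> W u v x t) = sets (messages_space \<mu> t)"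
      using mg'[OF x] by (simp add: space_prob_algebra)
    have "x (Suc t) \<in> space X" using x by (auto simp: space_PiM)
    then have "(\<lambda>y. A (x (Suc t)) y) \<in> messages_space \<mu> t \<rightarrow>\<^sub>M subprob_algebra (messages_space \<mu> (Suc t))"
      using A' by measurable
    then have "(\<lambda>y. A (x (Suc t)) y) \<in> messages_given \<mu> W u v x t \<rightarrow>\<^sub>M subprob_algebra (messages_space \<mu> (Suc t))"
      by measurable
    then show ?thesis
      using nn_integral_bind[OF f] by (simp add: A_def F_def)
  qed
  have m1: "(\<lambda>x. messages_given \<mu> W u v x s) \<in> (\<Pi>\<^sub>M s\<in>{1..s}. p) \<rightarrow>\<^sub>M subprob_algebra (messages_space \<mu> s)"
    if "s \<le> n" for s
  proof -
    have [measurable_cong]: "sets (\<Pi>\<^sub>M s\<in>{1..s}. p) = sets (\<Pi>\<^sub>M s\<in>{1..s}. X)"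
      by (intro sets_PiM_cong) (auto simp: sets_p)
    have "(\<lambda>x. (u, v, x)) \<in> (\<Pi>\<^sub>M s\<in>{1..s}. p) \<rightarrow>\<^sub>M Q \<Otimes>\<^sub>M RR \<Otimes>\<^sub>M (\<Pi>\<^sub>M s\<in>{1..s}. X)"
      using u v by measurable
    from measurable_compose[OF this measurable_prob_algebraD[OF measurable_messages_given[OF that order_refl]]]
    show ?thesis by simp
  qed
  have "(\<integral>\<^sup>+ x. (\<integral>\<^sup>+ y. f y \<partial>messages_given \<mu> W u v x (Suc t)) \<partial>(\<Pi>\<^sub>M s\<in>{1..Suc t}. p))
    = (\<integral>\<^sup>+ x. (\<integral>\<^sup>+ x'. (\<integral>\<^sup>+ y. f y \<partial>messages_given \<mu> W u v (x(Suc t := x')) (Suc t)) \<partial>p) \<partial>(\<Pi>\<^sub>M s\<in>{1..t}. p))"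
    using PP.product_nn_integral_insert[of "{1..t}" "Suc t" "\<lambda>x. \<integral>\<^sup>+ y. f y \<partial>messages_given \<mu> W u v x (Suc t)"]
      measurable_compose[OF m1[OF Suc.prems(1)] nn_integral_measurable_subprob_algebra[OF f]]
    unfolding ins by auto
  also have "\<dots> = (\<integral>\<^sup>+ x. (\<integral>\<^sup>+ x'. (\<integral>\<^sup>+ y. F x' y \<partial>messages_given \<mu> W u v x t) \<partial>p) \<partial>(\<Pi>\<^sub>M s\<in>{1..t}. p))"
  proof (intro nn_integral_cong)
    fix x x' assume x: "x \<in> space (\<Pi>\<^sub>M s\<in>{1..t}. p)" and x': "x' \<in> space p"
    have "x(Suc t := x') \<in> space (\<Pi>\<^sub>M s\<in>{1..Suc t}. X)"
      using x x' sets_eq_imp_space_eq[OF sets_p] unfolding ins space_p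
      by (auto simp: space_PiM PiE_iff extensional_def)
    from 1[OF this] show "(\<integral>\<^sup>+ y. f y \<partial>messages_given \<mu> W u v (x(Suc t := x')) (Suc t))
        = (\<integral>\<^sup>+ y. F x' y \<partial>messages_given \<mu> W u v x t)"
      using messages_given_cong[of t "x(Suc t := x')" x \<mu> W u v] by simp
  qed
  also have "\<dots> = (\<integral>\<^sup>+ x. (\<integral>\<^sup>+ y. (\<integral>\<^sup>+ x'. F x' y \<partial>p) \<partial>messages_given \<mu> W u v x t) \<partial>(\<Pi>\<^sub>M s\<in>{1..t}. p))"
  proof (rule nn_integral_cong)
    fix x assume "x \<in> space (\<Pi>\<^sub>M s\<in>{1..t}. p)"
    then have "messages_given \<mu> W u v x t \<in> space (prob_algebra (messages_space \<mu> t))"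
      unfolding space_p by (rule mg[OF Suc_leD[OF Suc.prems(1)]])
    then have [measurable_cong]: "sets (messages_given \<mu> W u v x t) = sets (messages_space \<mu> t)"
      and M: "prob_space (messages_given \<mu> W u v x t)"
      by (auto simp: space_prob_algebra)
    interpret M: prob_space "messages_given \<mu> W u v x t" by (rule M)
    interpret pair_sigma_finite p "messages_given \<mu> W u v x t" ..
    show "(\<integral>\<^sup>+ x'. (\<integral>\<^sup>+ y. F x' y \<partial>messages_given \<mu> W u v x t) \<partial>p)
        = (\<integral>\<^sup>+ y. (\<integral>\<^sup>+ x'. F x' y \<partial>p) \<partial>messages_given \<mu> W u v x t)"
      by (rule Fubini'[symmetric]) measurable
  qed
  also have "\<dots> = (\<integral>\<^sup>+ y. (\<integral>\<^sup>+ x'. F x' y \<partial>p) \<partial>round_law \<mu> (K u v) p t)"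
    using Suc.prems by (intro Suc.IH) measurable
  also have "\<dots> = (\<integral>\<^sup>+ y. f y \<partial>round_law \<mu> (K u v) p (Suc t))"
  proof -
    have L: "round_law \<mu> (K u v) p t \<in> space (prob_algebra (messages_space \<mu> t))"
      using Suc.prems by (intro K.round_law_in_prob_algebra p) simp
    then have sets_L[measurable_cong]: "sets (round_law \<mu> (K u v) p t) = sets (messages_space \<mu> t)"
      by (simp add: space_prob_algebra)
    let ?N = "\<lambda>y. (p \<bind> (\<lambda>x. K u v (Suc t) x y)) \<bind> (\<lambda>y'. return (messages_space \<mu> (Suc t)) (y(Suc t := y')))"
    have N: "?N \<in> round_law \<mu> (K u v) p t \<rightarrow>\<^sub>M subprob_algebra (messages_space \<mu> (Suc t))"
      using measurable_prob_algebraD[OF K.measurable_append_law[OF Suc.prems(1) p]] by measurable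
    \<comment> \<open>By associativity of bind, averaging the message over the input and then
      appending it is the same as appending it for a given input and averaging afterwards.\<close>
    have "(\<integral>\<^sup>+ z. f z \<partial>?N y) = (\<integral>\<^sup>+ x'. F x' y \<partial>p)" if y: "y \<in> space (messages_space \<mu> t)" for y
    proof -
      have k: "(\<lambda>x. K u v (Suc t) x y) \<in> p \<rightarrow>\<^sub>M subprob_algebra \<mu>"
      proof -
        have "(\<lambda>(x, y). K u v (Suc t) x y) \<in> X \<Otimes>\<^sub>M messages_space \<mu> t \<rightarrow>\<^sub>M subprob_algebra \<mu>"
          using measurable_prob_algebraD[OF K.kernel[of "Suc t"]] Suc.prems by simp
        then show ?thesis using y by measurable
      qed
      have r: "(\<lambda>y'. return (messages_space \<mu> (Suc t)) (y(Suc t := y'))) \<in> \<mu> \<rightarrow>\<^sub>M subprob_algebra (messages_space \<mu> (Suc t))"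
        using measurable_compose[OF measurable_compose[OF measurable_Pair1'[OF y] measurable_append_message] return_measurable]
        by simp
      have "?N y = p \<bind> (\<lambda>x. A x y)"
        unfolding A_def by (rule bind_assoc[OF k r])
      moreover have "(\<lambda>x. A x y) \<in> p \<rightarrow>\<^sub>M subprob_algebra (messages_space \<mu> (Suc t))"
        using A' y by measurable
      ultimately show ?thesis
        by (simp add: nn_integral_bind[OF f] F_def)
    qed
    then show ?thesis
      unfolding round_law.simps nn_integral_bind[OF f N]
      by (intro nn_integral_cong) (simp add: sets_eq_imp_space_eq[OF sets_L])
  qed
  finally show ?case .
qed

text \<open>For fixed \<open>(u, v)\<close>, mixing \<open>messages_given\<close> over the product
  law of the inputs gives \<open>round_law\<close>. Measurability of \<open>round_law\<close> in
  \<open>(u, v)\<close> is read off from this identity, the mixture being visibly a measurable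
  kernel, instead of being traced through the recursion. For the second claim, the component U of
  the transcript is projected away and the inputs are integrated before the randomness.\<close>

lemma
  assumes p: "p \<in> space (prob_algebra X)"
  shows measurable_round_law: "(\<lambda>(u, v). round_law \<mu> (K u v) p n) \<in> Q \<Otimes>\<^sub>M RR \<rightarrow>\<^sub>M prob_algebra (messages_space \<mu> n)"
    and messages_law_eq: "messages_law n \<mu> Q R W p = (Q \<Otimes>\<^sub>M RR) \<bind> (\<lambda>(u, v). round_law \<mu> (K u v) p n)"
proof -
  let ?PP = "\<Pi>\<^sub>M s\<in>{1..n}. p" and ?PX = "\<Pi>\<^sub>M s\<in>{1..n}. X" and ?Y = "messages_space \<mu> n"
  interpret Q: prob_space Q by (rule Q)
  interpret RR: prob_space RR by (rule RR)
  have PP: "?PP \<in> space (prob_algebra ?PX)" by (rule PiM_in_prob_algebra[OF p])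
  interpret PP: prob_space ?PP using PP by (simp add: space_prob_algebra)
  have sets_PP[measurable_cong]: "sets ?PP = sets ?PX" using PP by (simp add: space_prob_algebra)
  interpret QR: pair_sigma_finite Q RR ..
  interpret QR: prob_space "Q \<Otimes>\<^sub>M RR" by (rule prob_space_pair) unfold_locales
  interpret RP: pair_sigma_finite RR ?PP ..
  interpret RP: prob_space "RR \<Otimes>\<^sub>M ?PP" by (rule prob_space_pair) unfold_locales
  interpret T: prob_space "Q \<Otimes>\<^sub>M RR \<Otimes>\<^sub>M ?PP" by (rule prob_space_pair) unfold_locales
  have mg: "(\<lambda>(u, v, x). messages_given \<mu> W u v x n) \<in> Q \<Otimes>\<^sub>M RR \<Otimes>\<^sub>M ?PX \<rightarrow>\<^sub>M prob_algebra ?Y"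
    by (rule measurable_messages_given) auto
  have mg': "(\<lambda>(u, v, x). messages_given \<mu> W u v x n) \<in> Q \<Otimes>\<^sub>M RR \<Otimes>\<^sub>M ?PP \<rightarrow>\<^sub>M subprob_algebra ?Y"
    using measurable_prob_algebraD[OF mg] by measurable
  have bind_eq: "emeasure (?PP \<bind> (\<lambda>x. messages_given \<mu> W u v x n)) A = emeasure (round_law \<mu> (K u v) p n) A"
    "(\<integral>\<^sup>+ x. emeasure (messages_given \<mu> W u v x n) A \<partial>?PP) = emeasure (round_law \<mu> (K u v) p n) A"
    if u: "u \<in> space Q" and v: "v \<in> space RR" and A: "A \<in> sets ?Y" for u v A
  proof -
    interpret K: round_kernels n X \<mu> "K u v" by (rule K_kernels[OF u v])
    have "(\<lambda>x. (u, v, x)) \<in> ?PP \<rightarrow>\<^sub>M Q \<Otimes>\<^sub>M RR \<Otimes>\<^sub>M ?PP"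
      using u v by measurable
    from measurable_compose[OF this mg']
    have m: "(\<lambda>x. messages_given \<mu> W u v x n) \<in> ?PP \<rightarrow>\<^sub>M subprob_algebra ?Y" by simp
    have "(\<integral>\<^sup>+ x. emeasure (messages_given \<mu> W u v x n) A \<partial>?PP)
      = (\<integral>\<^sup>+ x. (\<integral>\<^sup>+ y. indicator A y \<partial>messages_given \<mu> W u v x n) \<partial>?PP)"
      using sets_kernel[OF m] A by (intro nn_integral_cong) simp
    also have "\<dots> = (\<integral>\<^sup>+ y. indicator A y \<partial>round_law \<mu> (K u v) p n)"
      using A by (intro nn_integral_messages_given[OF p u v]) auto
    also have "\<dots> = emeasure (round_law \<mu> (K u v) p n) A"
      using K.round_law_in_prob_algebra[OF order_refl p] A by (simp add: space_prob_algebra)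
    finally show *: "(\<integral>\<^sup>+ x. emeasure (messages_given \<mu> W u v x n) A \<partial>?PP) = emeasure (round_law \<mu> (K u v) p n) A" .
    then show "emeasure (?PP \<bind> (\<lambda>x. messages_given \<mu> W u v x n)) A = emeasure (round_law \<mu> (K u v) p n) A"
      using emeasure_bind[OF PP.not_empty m A] by simp
  qed
  have b: "(\<lambda>q. ?PP \<bind> (\<lambda>x. messages_given \<mu> W (fst q) (snd q) x n)) \<in> Q \<Otimes>\<^sub>M RR \<rightarrow>\<^sub>M prob_algebra ?Y"
  proof (rule measurable_bind_prob_space2[OF measurable_const[OF PP]])
    have "(\<lambda>(q, x). (fst q, snd q, x)) \<in> (Q \<Otimes>\<^sub>M RR) \<Otimes>\<^sub>M ?PX \<rightarrow>\<^sub>M Q \<Otimes>\<^sub>M RR \<Otimes>\<^sub>M ?PX"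
      by measurable
    from measurable_compose[OF this mg]
    show "(\<lambda>(q, x). messages_given \<mu> W (fst q) (snd q) x n) \<in> (Q \<Otimes>\<^sub>M RR) \<Otimes>\<^sub>M ?PX \<rightarrow>\<^sub>M prob_algebra ?Y"
      by (simp add: case_prod_beta')
  qed
  show law: "(\<lambda>(u, v). round_law \<mu> (K u v) p n) \<in> Q \<Otimes>\<^sub>M RR \<rightarrow>\<^sub>M prob_algebra ?Y"
  proof (rule measurable_cong[THEN iffD1, OF _ b])
    fix q assume q: "q \<in> space (Q \<Otimes>\<^sub>M RR)"
    then have u: "fst q \<in> space Q" and v: "snd q \<in> space RR" by (auto simp: space_pair_measure)
    interpret K: round_kernels n X \<mu> "K (fst q) (snd q)" by (rule K_kernels[OF u v])
    have "?PP \<bind> (\<lambda>x. messages_given \<mu> W (fst q) (snd q) x n) = round_law \<mu> (K (fst q) (snd q)) p n"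
    proof (rule measure_eqI)
      have s: "sets (?PP \<bind> (\<lambda>x. messages_given \<mu> W (fst q) (snd q) x n)) = sets ?Y"
        using measurable_space[OF b q] by (simp add: space_prob_algebra)
      then show "sets (?PP \<bind> (\<lambda>x. messages_given \<mu> W (fst q) (snd q) x n))
          = sets (round_law \<mu> (K (fst q) (snd q)) p n)"
        using K.round_law_in_prob_algebra[OF order_refl p] by (simp add: space_prob_algebra)
      show "emeasure (?PP \<bind> (\<lambda>x. messages_given \<mu> W (fst q) (snd q) x n)) A
          = emeasure (round_law \<mu> (K (fst q) (snd q)) p n) A"
        if "A \<in> sets (?PP \<bind> (\<lambda>x. messages_given \<mu> W (fst q) (snd q) x n))" for A
        using that unfolding s by (rule bind_eq(1)[OF u v])
    qed
    then show "?PP \<bind> (\<lambda>x. messages_given \<mu> W (fst q) (snd q) x n) = (case q of (u, v) \<Rightarrow> round_law \<mu> (K u v) p n)"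
      by (simp add: case_prod_beta')
  qed
  let ?k = "\<lambda>(u, v, x). messages_given \<mu> W u v x n \<bind> (\<lambda>y. return (?Y \<Otimes>\<^sub>M Q) (y, u))"
  have k: "?k \<in> Q \<Otimes>\<^sub>M RR \<Otimes>\<^sub>M ?PP \<rightarrow>\<^sub>M subprob_algebra (?Y \<Otimes>\<^sub>M Q)"
  proof -
    have "(\<lambda>q. messages_given \<mu> W (fst q) (fst (snd q)) (snd (snd q)) n \<bind> (\<lambda>y. return (?Y \<Otimes>\<^sub>M Q) (y, fst q)))
        \<in> Q \<Otimes>\<^sub>M RR \<Otimes>\<^sub>M ?PP \<rightarrow>\<^sub>M subprob_algebra (?Y \<Otimes>\<^sub>M Q)"
      using mg' by (intro measurable_bind[where N = ?Y]) (simp_all add: case_prod_beta')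
    then show ?thesis by (simp add: case_prod_beta')
  qed
  \<comment> \<open>The projection is pushed inside the bind, where it cancels the pairing of the
    messages with the fixed value \<open>u\<close>.\<close>
  have "messages_law n \<mu> Q R W p = (Q \<Otimes>\<^sub>M RR \<Otimes>\<^sub>M ?PP) \<bind> (\<lambda>q. distr (?k q) ?Y fst)"
    unfolding messages_law_def transcript_def by (rule distr_bind[OF k T.not_empty]) simp
  also have "\<dots> = (Q \<Otimes>\<^sub>M RR \<Otimes>\<^sub>M ?PP) \<bind> (\<lambda>(u, v, x). messages_given \<mu> W u v x n)"
  proof (rule bind_cong[OF refl])
    fix q assume q: "q \<in> space (Q \<Otimes>\<^sub>M RR \<Otimes>\<^sub>M ?PP)"
    obtain u v x where [simp]: "q = (u, v, x)" by (cases q)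
    have u: "u \<in> space Q" using q by (simp add: space_pair_measure)
    have sets_m: "sets (messages_given \<mu> W u v x n) = sets ?Y"
      using sets_kernel[OF mg' q] by simp
    note [measurable_cong] = sets_m
    have ne: "space (messages_given \<mu> W u v x n) \<noteq> {}"
      using subprob_space.subprob_not_empty[OF subprob_space_kernel[OF mg' q]] by simp
    have pm: "(\<lambda>y. (y, u)) \<in> messages_given \<mu> W u v x n \<rightarrow>\<^sub>M ?Y \<Otimes>\<^sub>M Q"
      using u by measurable
    from pm have "?k q = distr (messages_given \<mu> W u v x n) (?Y \<Otimes>\<^sub>M Q) (\<lambda>y. (y, u))"
      by (simp add: bind_return_distr'[OF ne])
    then have "distr (?k q) ?Y fst = distr (messages_given \<mu> W u v x n) ?Y (\<lambda>y. y)"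
      using distr_distr[OF measurable_fst pm] by (simp only: comp_def fst_conv)
    also have "\<dots> = messages_given \<mu> W u v x n"
      using distr_id2[OF sets_m[symmetric]] .
    finally show "distr (?k q) ?Y fst = (case q of (u, v, x) \<Rightarrow> messages_given \<mu> W u v x n)"
      by simp
  qed
  also have "\<dots> = (Q \<Otimes>\<^sub>M RR) \<bind> (\<lambda>(u, v). round_law \<mu> (K u v) p n)"
  proof (rule measure_eqI)
    have s: "sets ((Q \<Otimes>\<^sub>M RR \<Otimes>\<^sub>M ?PP) \<bind> (\<lambda>(u, v, x). messages_given \<mu> W u v x n)) = sets ?Y"
      by (rule sets_bind_measurable[OF mg' T.not_empty])
    moreover have "sets ((Q \<Otimes>\<^sub>M RR) \<bind> (\<lambda>(u, v). round_law \<mu> (K u v) p n)) = sets ?Y"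
      by (rule sets_bind_measurable[OF measurable_prob_algebraD[OF law] QR.not_empty])
    ultimately show "sets ((Q \<Otimes>\<^sub>M RR \<Otimes>\<^sub>M ?PP) \<bind> (\<lambda>(u, v, x). messages_given \<mu> W u v x n))
        = sets ((Q \<Otimes>\<^sub>M RR) \<bind> (\<lambda>(u, v). round_law \<mu> (K u v) p n))" by simp
    fix A assume "A \<in> sets ((Q \<Otimes>\<^sub>M RR \<Otimes>\<^sub>M ?PP) \<bind> (\<lambda>(u, v, x). messages_given \<mu> W u v x n))"
    then have A: "A \<in> sets ?Y" using s by simp
    have e: "(\<lambda>(u, v, x). emeasure (messages_given \<mu> W u v x n) A) \<in> borel_measurable (Q \<Otimes>\<^sub>M RR \<Otimes>\<^sub>M ?PP)"
      using measurable_compose[OF mg' measurable_emeasure_subprob_algebra[OF A]] by (simp add: case_prod_beta')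
    have e2: "(\<lambda>(u, v). emeasure (round_law \<mu> (K u v) p n) A) \<in> borel_measurable (Q \<Otimes>\<^sub>M RR)"
      using measurable_compose[OF measurable_prob_algebraD[OF law] measurable_emeasure_subprob_algebra[OF A]]
      by (simp add: case_prod_beta')
    have "emeasure ((Q \<Otimes>\<^sub>M RR \<Otimes>\<^sub>M ?PP) \<bind> (\<lambda>(u, v, x). messages_given \<mu> W u v x n)) A
      = (\<integral>\<^sup>+ (u, v, x). emeasure (messages_given \<mu> W u v x n) A \<partial>(Q \<Otimes>\<^sub>M RR \<Otimes>\<^sub>M ?PP))"
      using emeasure_bind[OF T.not_empty mg' A] by (simp add: case_prod_beta')
    also have "\<dots> = (\<integral>\<^sup>+ u. (\<integral>\<^sup>+ (v, x). emeasure (messages_given \<mu> W u v x n) A \<partial>(RR \<Otimes>\<^sub>M ?PP)) \<partial>Q)"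
      using RP.nn_integral_fst[OF e] by simp
    also have "\<dots> = (\<integral>\<^sup>+ u. (\<integral>\<^sup>+ v. (\<integral>\<^sup>+ x. emeasure (messages_given \<mu> W u v x n) A \<partial>?PP) \<partial>RR) \<partial>Q)"
    proof (rule nn_integral_cong)
      fix u assume u: "u \<in> space Q"
      have "(\<lambda>(v, x). emeasure (messages_given \<mu> W u v x n) A) \<in> borel_measurable (RR \<Otimes>\<^sub>M ?PP)"
        using measurable_compose[OF measurable_Pair1'[OF u] e] by (simp add: case_prod_beta')
      from PP.nn_integral_fst[OF this]
      show "(\<integral>\<^sup>+ (v, x). emeasure (messages_given \<mu> W u v x n) A \<partial>(RR \<Otimes>\<^sub>M ?PP))
          = (\<integral>\<^sup>+ v. (\<integral>\<^sup>+ x. emeasure (messages_given \<mu> W u v x n) A \<partial>?PP) \<partial>RR)" by simp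
    qed
    also have "\<dots> = (\<integral>\<^sup>+ u. (\<integral>\<^sup>+ v. emeasure (round_law \<mu> (K u v) p n) A \<partial>RR) \<partial>Q)"
      by (intro nn_integral_cong bind_eq(2) A)
    also have "\<dots> = (\<integral>\<^sup>+ (u, v). emeasure (round_law \<mu> (K u v) p n) A \<partial>(Q \<Otimes>\<^sub>M RR))"
      using RR.nn_integral_fst[OF e2] by simp
    also have "\<dots> = emeasure ((Q \<Otimes>\<^sub>M RR) \<bind> (\<lambda>(u, v). round_law \<mu> (K u v) p n)) A"
      using emeasure_bind[OF QR.not_empty measurable_prob_algebraD[OF law] A] by (simp add: case_prod_beta')
    finally show "emeasure ((Q \<Otimes>\<^sub>M RR \<Otimes>\<^sub>M ?PP) \<bind> (\<lambda>(u, v, x). messages_given \<mu> W u v x n)) A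
      = emeasure ((Q \<Otimes>\<^sub>M RR) \<bind> (\<lambda>(u, v). round_law \<mu> (K u v) p n)) A" .
  qed
  finally show "messages_law n \<mu> Q R W p = (Q \<Otimes>\<^sub>M RR) \<bind> (\<lambda>(u, v). round_law \<mu> (K u v) p n)" .
qed

section \<open>Distances of message laws averaged over the randomness\<close>

lemma
  assumes p: "p \<in> space (prob_algebra X)"
  shows messages_law_in_prob_algebra: "messages_law n \<mu> Q R W p \<in> space (prob_algebra (messages_space \<mu> n))"
    and measure_messages_law: "A \<in> sets (messages_space \<mu> n) \<Longrightarrow>
      measure (messages_law n \<mu> Q R W p) A = (\<integral>(u, v). measure (round_law \<mu> (K u v) p n) A \<partial>(Q \<Otimes>\<^sub>M RR))"
    and integrable_measure_round_law: "A \<in> sets (messages_space \<mu> n) \<Longrightarrow>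
      integrable (Q \<Otimes>\<^sub>M RR) (\<lambda>(u, v). measure (round_law \<mu> (K u v) p n) A)"
proof -
  interpret Q: prob_space Q by (rule Q)
  interpret RR: prob_space RR by (rule RR)
  interpret QR: pair_sigma_finite Q RR ..
  interpret QR: prob_space "Q \<Otimes>\<^sub>M RR" by (rule prob_space_pair) unfold_locales
  have QR: "Q \<Otimes>\<^sub>M RR \<in> space (prob_algebra (Q \<Otimes>\<^sub>M RR))"
    unfolding space_prob_algebra using QR.prob_space_axioms by blast
  note law = measurable_round_law[OF p]
  show "messages_law n \<mu> Q R W p \<in> space (prob_algebra (messages_space \<mu> n))"
    using prob_space_bind'[OF QR law] sets_bind'[OF QR law] messages_law_eq[OF p]
    by (simp add: space_prob_algebra)
  assume A: "A \<in> sets (messages_space \<mu> n)"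
  show "measure (messages_law n \<mu> Q R W p) A = (\<integral>(u, v). measure (round_law \<mu> (K u v) p n) A \<partial>(Q \<Otimes>\<^sub>M RR))"
    unfolding messages_law_eq[OF p]
    using QR.measure_bind[OF measurable_prob_algebraD[OF law] A] by (simp add: case_prod_beta')
  have "(\<lambda>q. measure (case q of (u, v) \<Rightarrow> round_law \<mu> (K u v) p n) A) \<in> borel_measurable (Q \<Otimes>\<^sub>M RR)"
    by (rule measurable_compose[OF measurable_prob_algebraD[OF law] measurable_measure_subprob_algebra[OF A]])
  moreover have "measure (case q of (u, v) \<Rightarrow> round_law \<mu> (K u v) p n) A \<le> 1" if "q \<in> space (Q \<Otimes>\<^sub>M RR)" for q
    using measurable_space[OF law that] by (auto simp: space_prob_algebra intro: prob_space.prob_le_1)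
  ultimately have "integrable (Q \<Otimes>\<^sub>M RR) (\<lambda>q. measure (case q of (u, v) \<Rightarrow> round_law \<mu> (K u v) p n) A)"
    by (intro QR.integrable_const_bound[where B = 1] AE_I2) auto
  then show "integrable (Q \<Otimes>\<^sub>M RR) (\<lambda>(u, v). measure (round_law \<mu> (K u v) p n) A)"
    by (simp add: case_prod_beta')
qed

lemma K_channel:
  assumes "u \<in> space Q" "v \<in> space RR" "t \<in> {1..n}" "y \<in> space (messages_space \<mu> (t - 1))"
  shows "\<exists>V\<in>\<W> t. \<forall>x\<in>space X. K u v t x y = V x"
proof -
  have "v t \<in> space (R t)" using assms(2,3) by (auto simp: space_PiM)
  then show ?thesis using protocol assms by (auto simp: seq_interactive_protocol_def)
qed

text \<open>The events \<open>A i\<close> do not depend on the randomness, so the triangle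
  inequality can be applied under the integral over \<open>(u, v)\<close>. There the squared
  distances are bounded by a constant independent of \<open>(u, v)\<close>, and Cauchy-Schwarz turns
  this into a bound on the sum of absolute values at the price of the factor
  \<open>card J\<close>.\<close>

lemma sum_messages_law_distance:
  assumes J: "finite J" and mu: "sigma_finite_measure \<mu>"
    and p: "prob_space p" "sets p = sets X"
    and q: "\<And>i. i \<in> J \<Longrightarrow> prob_space (q i)" "\<And>i. i \<in> J \<Longrightarrow> sets (q i) = sets X"
      "\<And>i. i \<in> J \<Longrightarrow> absolutely_continuous p (q i)"
    and \<phi>: "\<And>i. i \<in> J \<Longrightarrow> \<phi> i \<in> borel_measurable X"
    and RN: "\<And>i. i \<in> J \<Longrightarrow> AE x in p. enn2real (RN_deriv p (q i) x) = 1 + a i * \<phi> i x"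
    and channels: "\<And>t. t \<in> {1..n} \<Longrightarrow> \<W> t \<subseteq> channels X \<mu>"
    and d: "\<And>t V. t \<in> {1..n} \<Longrightarrow> V \<in> \<W> t \<Longrightarrow>
      (\<Sum>i\<in>J. ennreal ((a i)\<^sup>2) * (\<integral>\<^sup>+ y. ennreal ((\<integral>x. \<phi> i x * channel_density X \<mu> V x y \<partial>p)\<^sup>2
        / (\<integral>x. channel_density X \<mu> V x y \<partial>p)) \<partial>\<mu>)) \<le> ennreal (d t)"
    and d_nonneg: "\<And>t. t \<in> {1..n} \<Longrightarrow> 0 \<le> d t"
    and A: "\<And>i. i \<in> J \<Longrightarrow> A i \<in> sets (messages_space \<mu> n)"
  shows "(\<Sum>i\<in>J. \<bar>measure (messages_law n \<mu> Q R W p) (A i) - measure (messages_law n \<mu> Q R W (q i)) (A i)\<bar>)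
    \<le> sqrt (real (card J) * (9 / 2 * (\<Sum>s=1..n. d s)))"
    (is "_ \<le> ?B")
proof -
  interpret Q: prob_space Q by (rule Q)
  interpret RR: prob_space RR by (rule RR)
  interpret QR: pair_sigma_finite Q RR ..
  interpret QR: prob_space "Q \<Otimes>\<^sub>M RR" by (rule prob_space_pair) unfold_locales
  have pp: "p \<in> space (prob_algebra X)" and qq: "\<And>i. i \<in> J \<Longrightarrow> q i \<in> space (prob_algebra X)"
    using p q by (auto simp: space_prob_algebra)
  let ?m = "\<lambda>r i w. measure (round_law \<mu> (K (fst w) (snd w)) r n) (A i)"
  have pw: "(\<Sum>i\<in>J. \<bar>?m p i w - ?m (q i) i w\<bar>) \<le> ?B" if w: "w \<in> space (Q \<Otimes>\<^sub>M RR)" for w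
  proof -
    have u: "fst w \<in> space Q" and v: "snd w \<in> space RR" using w by (auto simp: space_pair_measure)
    interpret round_kernels n X \<mu> "K (fst w) (snd w)" by (rule K_kernels[OF u v])
    interpret information_rounds n X \<mu> "K (fst w) (snd w)" J p q a \<phi> \<W> d
      by (intro information_rounds.intro information_rounds_axioms.intro round_kernels_axioms)
        ((rule J mu p q \<phi> RN channels K_channel[OF u v] d d_nonneg; assumption)+)
    have "(\<Sum>i\<in>J. \<bar>?m p i w - ?m (q i) i w\<bar>)\<^sup>2 \<le> real (card J) * (\<Sum>i\<in>J. \<bar>?m p i w - ?m (q i) i w\<bar>\<^sup>2)"
      using Cauchy_Schwarz_ineq_sum[of "\<lambda>_. 1" "\<lambda>i. \<bar>?m p i w - ?m (q i) i w\<bar>" J] by simp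
    also have "\<dots> \<le> real (card J) * (9 / 2 * (\<Sum>s=1..n. d s))"
      using squared_distance_bound[of A] A by (intro mult_left_mono) auto
    finally show ?thesis by (rule real_le_rsqrt)
  qed
  have int: "integrable (Q \<Otimes>\<^sub>M RR) (?m r i)" if "r \<in> space (prob_algebra X)" "i \<in> J" for r i
    using integrable_measure_round_law[OF that(1) A[OF that(2)]] by (simp add: case_prod_beta')
  have law: "measure (messages_law n \<mu> Q R W r) (A i) = (\<integral>w. ?m r i w \<partial>(Q \<Otimes>\<^sub>M RR))"
    if "r \<in> space (prob_algebra X)" "i \<in> J" for r i
    using measure_messages_law[OF that(1) A[OF that(2)]] by (simp add: case_prod_beta')
  have "(\<Sum>i\<in>J. \<bar>measure (messages_law n \<mu> Q R W p) (A i) - measure (messages_law n \<mu> Q R W (q i)) (A i)\<bar>)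
    = (\<Sum>i\<in>J. \<bar>\<integral>w. ?m p i w - ?m (q i) i w \<partial>(Q \<Otimes>\<^sub>M RR)\<bar>)"
    using int pp qq by (intro sum.cong refl) (simp add: law)
  also have "\<dots> \<le> (\<Sum>i\<in>J. \<integral>w. \<bar>?m p i w - ?m (q i) i w\<bar> \<partial>(Q \<Otimes>\<^sub>M RR))"
    by (intro sum_mono integral_abs_bound)
  also have "\<dots> = (\<integral>w. (\<Sum>i\<in>J. \<bar>?m p i w - ?m (q i) i w\<bar>) \<partial>(Q \<Otimes>\<^sub>M RR))"
    using int pp qq by (intro Bochner_Integration.integral_sum[symmetric]) auto
  also have "\<dots> \<le> ?B"
    using int pp qq by (intro QR.integral_le_const AE_I2 pw) auto
  finally show ?thesis .
qed

end

section \<open>Averaging over the cube\<close>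

lemma cond_pair_pmf_fst:
  assumes "s \<in> set_pmf A"
  shows "cond_pmf (pair_pmf A B) (fst -` {s}) = map_pmf (Pair s) B"
proof -
  have ne: "set_pmf (pair_pmf A B) \<inter> fst -` {s} \<noteq> {}"
    using assms set_pmf_not_empty[of B] by fastforce
  have m: "measure (pair_pmf A B) (fst -` {s}) = pmf A s"
    using measure_map_pmf[of fst "pair_pmf A B" "{s}"]
    by (simp add: map_fst_pair_pmf measure_pmf_single)
  have "cond_pmf (pair_pmf A B) (fst -` {s}) = pair_pmf (return_pmf s) B"
  proof (rule pmf_eqI)
    fix x :: "'a \<times> 'b"
    show "pmf (cond_pmf (pair_pmf A B) (fst -` {s})) x = pmf (pair_pmf (return_pmf s) B) x"
      using assms by (cases x) (simp add: pmf_cond[OF ne] m pmf_pair set_pmf_iff indicator_def)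
  qed
  then show ?thesis by (simp add: pair_return_pmf1)
qed

text \<open>Z is the image of an independent pair, its coordinate \<open>i\<close> and the rest, and
  conditioning touches only the first component. Both signs have positive probability because 0 <
  \<tau> < 1, so the conditional law is meaningful for either value of \<open>s\<close>.\<close>

lemma cond_Rad_power:
  assumes tau: "0 < \<tau>" "\<tau> < 1" and i: "i \<in> {1..k}" and s: "s \<in> {-1, 1}"
  shows "cond_pmf (Rad_power k \<tau>) {z. z i = s} = map_pmf (\<lambda>z. z(i := s)) (Rad_power k \<tau>)"
proof -
  define F where "F = Pi_pmf ({1..k} - {i}) undefined (\<lambda>_. Rad \<tau>)"
  define g where "g = (\<lambda>(y, f). f(i := y) :: nat \<Rightarrow> int)"
  have RP: "Rad_power k \<tau> = map_pmf g (pair_pmf (Rad \<tau>) F)"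
    using Pi_pmf_insert[of "{1..k} - {i}" i undefined "\<lambda>_. Rad \<tau>"] i
    by (simp add: Rad_power_def F_def g_def insert_absorb)
  have s': "s \<in> set_pmf (Rad \<tau>)"
    using tau s by (auto simp: Rad_def set_pmf_bernoulli)
  have vim: "g -` {z. z i = s} = fst -` {s}"
    by (auto simp: g_def)
  have ne: "set_pmf (pair_pmf (Rad \<tau>) F) \<inter> fst -` {s} \<noteq> {}"
    using s' set_pmf_not_empty[of F] by fastforce
  have "cond_pmf (Rad_power k \<tau>) {z. z i = s} = map_pmf g (cond_pmf (pair_pmf (Rad \<tau>) F) (fst -` {s}))"
    unfolding RP using cond_map_pmf[of "pair_pmf (Rad \<tau>) F" g "{z. z i = s}"] ne unfolding vim by blast
  also have "\<dots> = map_pmf (\<lambda>f. f(i := s)) F"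
    by (simp add: cond_pair_pmf_fst[OF s'] map_pmf_comp g_def)
  \<comment> \<open>Coordinate \<open>i\<close> is overwritten anyway, so it may be drawn afresh;
    this restores the full product law.\<close>
  also have "\<dots> = map_pmf (\<lambda>f. f(i := s)) (map_pmf snd (pair_pmf (Rad \<tau>) F))"
    by (simp add: map_snd_pair_pmf)
  also have "\<dots> = map_pmf (\<lambda>z. z(i := s)) (Rad_power k \<tau>)"
    by (simp add: RP map_pmf_comp g_def case_prod_beta')
  finally show ?thesis .
qed

section \<open>Mixtures over the support of Z\<close>

lemma set_Rad_power: "set_pmf (Rad_power k \<tau>) \<subseteq> cube k"
proof
  fix z assume z: "z \<in> set_pmf (Rad_power k \<tau>)"
  have "set_pmf (Rad \<tau>) \<subseteq> {-1, 1}"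
    by (auto simp: Rad_def)
  then show "z \<in> cube k"
    using z by (auto simp: Rad_power_def set_Pi_pmf cube_def PiE_dflt_def PiE_iff extensional_def)
qed

lemma finite_cube: "finite (cube k)"
  by (auto simp: cube_def intro!: finite_PiE)

text \<open>The restricted space carries all subsets of the support as measurable sets, so
  measurability of \<open>f\<close> reduces to its values there lying in
  \<open>space (prob_algebra N)\<close>.\<close>

lemma
  assumes f: "\<And>z. z \<in> set_pmf P \<Longrightarrow> f z \<in> space (prob_algebra N)"
  shows mixture_in_prob_algebra: "mixture P f \<in> space (prob_algebra N)"
    and measure_mixture: "A \<in> sets N \<Longrightarrow> measure (mixture P f) A = (\<integral>z. measure (f z) A \<partial>P)"
proof -
  let ?M = "restrict_space (measure_pmf P) (set_pmf P)"
  interpret M: prob_space ?M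
    by (rule prob_space_restrict_space) (auto simp: measure_pmf.emeasure_eq_measure measure_pmf.prob_eq_1 AE_measure_pmf)
  have M: "?M \<in> space (prob_algebra ?M)"
    by (simp add: space_prob_algebra M.prob_space_axioms)
  have fm: "f \<in> ?M \<rightarrow>\<^sub>M prob_algebra N"
    using f by (intro measurableI) (auto simp: sets_restrict_space space_restrict_space image_iff)
  show "mixture P f \<in> space (prob_algebra N)"
    using prob_space_bind'[OF M fm] sets_bind'[OF M fm] by (simp add: mixture_def space_prob_algebra)
  assume A: "A \<in> sets N"
  have "measure (mixture P f) A = (\<integral>z. measure (f z) A \<partial>?M)"
    unfolding mixture_def by (rule M.measure_bind[OF measurable_prob_algebraD[OF fm] A])
  also have "\<dots> = (\<integral>z. indicator (set_pmf P) z *\<^sub>R measure (f z) A \<partial>P)"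
    by (rule integral_restrict_space) simp
  also have "\<dots> = (\<integral>z. measure (f z) A \<partial>P)"
    by (rule integral_cong_AE) (auto simp: AE_measure_pmf_iff)
  finally show "measure (mixture P f) A = (\<integral>z. measure (f z) A \<partial>P)" .
qed

text \<open>The points \<open>A i\<close> are chosen independently of each other, so a bound for all
  choices bounds the sum of the suprema. Suprema are pulled out one at a time: with the point for
  \<open>j\<close> fixed, its term moves to the other side and changes the constant, hence
  \<open>B\<close> is arbitrary in the induction. No approximate maximizers are needed.\<close>

lemma sum_SUP_le:
  fixes f :: "'i \<Rightarrow> 'a \<Rightarrow> real"
  assumes "finite I" and "\<And>i. i \<in> I \<Longrightarrow> S i \<noteq> {}"
    and "\<And>A. (\<And>i. i \<in> I \<Longrightarrow> A i \<in> S i) \<Longrightarrow> (\<Sum>i\<in>I. f i (A i)) \<le> B"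
  shows "(\<Sum>i\<in>I. SUP x\<in>S i. f i x) \<le> B"
  using assms
proof (induction I arbitrary: B rule: finite_induct)
  case empty
  then show ?case by simp
next
  case (insert j I)
  have "f j x \<le> B - (\<Sum>i\<in>I. SUP x\<in>S i. f i x)" if x: "x \<in> S j" for x
  proof -
    have "(\<Sum>i\<in>I. SUP x\<in>S i. f i x) \<le> B - f j x"
    proof (rule insert.IH)
      fix A assume A: "\<And>i. i \<in> I \<Longrightarrow> A i \<in> S i"
      have "(\<Sum>i\<in>insert j I. f i ((A(j := x)) i)) \<le> B"
        using A x by (intro insert.prems(2)) auto
      moreover have "(\<Sum>i\<in>I. f i ((A(j := x)) i)) = (\<Sum>i\<in>I. f i (A i))"
        using insert.hyps by (intro sum.cong) auto
      ultimately show "(\<Sum>i\<in>I. f i (A i)) \<le> B - f j x"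
        using insert.hyps by simp
    qed (use insert.prems in auto)
    then show ?thesis by simp
  qed
  then have "(SUP x\<in>S j. f j x) \<le> B - (\<Sum>i\<in>I. SUP x\<in>S i. f i x)"
    using insert.prems(1)[of j] by (intro cSUP_least) auto
  then show ?case using insert.hyps by simp
qed

lemma tv_dist_nonneg:
  assumes "P \<in> space (prob_algebra N)" "Q \<in> space (prob_algebra N)"
  shows "0 \<le> tv_dist P Q"
proof -
  interpret P: prob_space P using assms by (simp add: space_prob_algebra)
  interpret Q: prob_space Q using assms by (simp add: space_prob_algebra)
  have "\<bar>measure P A - measure Q A\<bar> \<le> 1" for A
    using P.prob_le_1[of A] Q.prob_le_1[of A] measure_nonneg[of P A] measure_nonneg[of Q A] by linarith
  then show ?thesis
    unfolding tv_dist_def by (intro cSUP_upper2[of _ _ "{}"] bdd_aboveI2[of _ _ 1]) auto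
qed

section \<open>From single sign flips to the two conditional mixtures\<close>

theorem theorem1:
  fixes k n :: nat and \<tau> \<alpha> :: real
    and X :: "'x measure" and \<mu> :: "'y measure"
    and p :: "(nat \<Rightarrow> int) \<Rightarrow> 'x measure"
    and a :: "(nat \<Rightarrow> int) \<Rightarrow> nat \<Rightarrow> real"
    and \<phi> :: "(nat \<Rightarrow> int) \<Rightarrow> nat \<Rightarrow> 'x \<Rightarrow> real"
    and \<W> :: "nat \<Rightarrow> ('x \<Rightarrow> 'y measure) set"
    and Q :: "'u measure" and R :: "nat \<Rightarrow> 'v measure"
    and W :: "nat \<Rightarrow> 'u \<Rightarrow> 'v \<Rightarrow> 'x \<Rightarrow> (nat \<Rightarrow> 'y) \<Rightarrow> 'y measure"
  defines "P \<equiv> \<lambda>z. messages_law n \<mu> Q R W (p z)"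
  defines "P_cond \<equiv> \<lambda>i s. mixture (cond_pmf (Rad_power k \<tau>) {z. z i = s}) P"
  assumes "k \<ge> 1" and "0 < \<tau>" and "\<tau> \<le> 1/2"
    and "sigma_finite_measure \<mu>"
    and "\<And>z. z \<in> cube k \<Longrightarrow> prob_space (p z)"
    and "\<And>z. z \<in> cube k \<Longrightarrow> sets (p z) = sets X"
    and "\<And>z i. z \<in> cube k \<Longrightarrow> i \<in> {1..k} \<Longrightarrow> absolutely_continuous (p z) (p (flip i z))"
    and "\<And>z i. z \<in> cube k \<Longrightarrow> i \<in> {1..k} \<Longrightarrow> \<bar>a z i\<bar> \<le> \<alpha>"
    and "\<And>z i. z \<in> cube k \<Longrightarrow> i \<in> {1..k} \<Longrightarrow> \<phi> z i \<in> borel_measurable X"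
    and "\<And>z i. z \<in> cube k \<Longrightarrow> i \<in> {1..k} \<Longrightarrow>
           AE x in p z. enn2real (RN_deriv (p z) (p (flip i z)) x) = 1 + a z i * \<phi> z i x"
    and "\<And>t. t \<in> {1..n} \<Longrightarrow> \<W> t \<subseteq> channels X \<mu>"
    and "seq_interactive_protocol n X \<mu> \<W> Q R W"
  shows "ennreal ((1 / real k * (\<Sum>i=1..k. tv_dist (P_cond i 1) (P_cond i (-1))))\<^sup>2)
    \<le> ennreal (7 / real k * \<alpha>\<^sup>2) *
       (\<Sum>t=1..n. SUP z\<in>cube k. SUP V\<in>\<W> t. \<Sum>i=1..k.
          \<integral>\<^sup>+ y. ennreal ((\<integral>x. \<phi> z i x * channel_density X \<mu> V x y \<partial>p z)\<^sup>2
                    / (\<integral>x. channel_density X \<mu> V x y \<partial>p z)) \<partial>\<mu>)"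
proof -
  note k = assms(3) and tau = assms(4,5) and mu = assms(6) and p = assms(7,8) and ac = assms(9)
    and a = assms(10) and \<phi> = assms(11) and RN = assms(12) and channels = assms(13)
  interpret protocol n X \<mu> \<W> Q R W by (rule protocol.intro[OF assms(14)])
  define I where "I z V i = (\<integral>\<^sup>+ y. ennreal ((\<integral>x. \<phi> z i x * channel_density X \<mu> V x y \<partial>p z)\<^sup>2
                    / (\<integral>x. channel_density X \<mu> V x y \<partial>p z)) \<partial>\<mu>)" for z V i
  define S where "S t = (SUP z\<in>cube k. SUP V\<in>\<W> t. \<Sum>i=1..k. I z V i)" for t
  have "ennreal ((1 / real k * (\<Sum>i=1..k. tv_dist (P_cond i 1) (P_cond i (-1))))\<^sup>2)
      \<le> ennreal (7 / real k * \<alpha>\<^sup>2) * (\<Sum>t=1..n. S t)"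
  proof (cases "ennreal (7 / real k * \<alpha>\<^sup>2) * (\<Sum>t=1..n. S t) = top")
    case True
    then show ?thesis by simp
  next
    case False
    have rhs: "ennreal (7 / real k * \<alpha>\<^sup>2) * (\<Sum>t=1..n. S t)
        = ennreal (7 / real k) * (\<Sum>t=1..n. ennreal (\<alpha>\<^sup>2) * S t)"
      by (simp add: ennreal_mult' sum_distrib_left mult.assoc del: times_divide_eq_left)
    \<comment> \<open>The product is made finite, not \<open>S t\<close> itself: for \<alpha> = 0
      the supremum \<open>S t\<close> may be infinite, while the product is 0 in
      \<open>ennreal\<close>.\<close>
    define d where "d t = enn2real (ennreal (\<alpha>\<^sup>2) * S t)" for t
    have d_eq: "ennreal (d t) = ennreal (\<alpha>\<^sup>2) * S t" if t: "t \<in> {1..n}" for t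
    proof -
      have "(\<Sum>t=1..n. ennreal (\<alpha>\<^sup>2) * S t) \<noteq> top"
        using False k unfolding rhs by (auto simp: ennreal_mult_eq_top_iff)
      then have "ennreal (\<alpha>\<^sup>2) * S t \<noteq> top"
        using member_le_sum[of t "{1..n}" "\<lambda>t. ennreal (\<alpha>\<^sup>2) * S t"] t by (auto simp: top_unique)
      then show ?thesis unfolding d_def by (simp add: less_top)
    qed
    define B where "B = sqrt (real k * (9 / 2 * (\<Sum>t=1..n. d t)))"
    have flip_cube: "flip i z \<in> cube k" if "z \<in> cube k" "i \<in> {1..k}" for i z
      using that by (auto simp: cube_def flip_def PiE_iff extensional_def)
    have P: "P z \<in> space (prob_algebra (messages_space \<mu> n))" if "z \<in> cube k" for z
      unfolding P_def using p[OF that] by (intro messages_law_in_prob_algebra) (simp add: space_prob_algebra)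

    \<comment> \<open>Here the base point \<open>z\<close> is fixed and the alternatives are its k
      neighbours in the cube. The supremum over \<open>z\<close> in \<open>S t\<close> makes
      \<open>B\<close> the same for all base points.\<close>
    have flip_dist: "(\<Sum>i=1..k. \<bar>measure (P z) (A i) - measure (P (flip i z)) (A i)\<bar>) \<le> B"
      if z: "z \<in> cube k" and A: "\<And>i. i \<in> {1..k} \<Longrightarrow> A i \<in> sets (messages_space \<mu> n)" for z A
    proof -
      have "(\<Sum>i\<in>{1..k}. ennreal ((a z i)\<^sup>2) * I z V i) \<le> ennreal (d t)"
        if t: "t \<in> {1..n}" and V: "V \<in> \<W> t" for t V
      proof -
        have "(a z i)\<^sup>2 \<le> \<alpha>\<^sup>2" if "i \<in> {1..k}" for i
          using power_mono[OF a[OF z that], of 2] by simp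
        then have "(\<Sum>i\<in>{1..k}. ennreal ((a z i)\<^sup>2) * I z V i) \<le> (\<Sum>i\<in>{1..k}. ennreal (\<alpha>\<^sup>2) * I z V i)"
          by (intro sum_mono mult_right_mono ennreal_leI) auto
        also have "\<dots> = ennreal (\<alpha>\<^sup>2) * (\<Sum>i\<in>{1..k}. I z V i)"
          by (simp add: sum_distrib_left)
        also have "\<dots> \<le> ennreal (\<alpha>\<^sup>2) * S t"
          unfolding S_def using z V by (intro mult_left_mono SUP_upper2[of z] SUP_upper2[of V]) auto
        finally show ?thesis by (simp add: d_eq[OF t])
      qed
      note d_bound = this[unfolded I_def]
      have "(\<Sum>i\<in>{1..k}. \<bar>measure (messages_law n \<mu> Q R W (p z)) (A i)
            - measure (messages_law n \<mu> Q R W (p (flip i z))) (A i)\<bar>)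
          \<le> sqrt (real (card {1..k}) * (9 / 2 * (\<Sum>s=1..n. d s)))"
        by (rule sum_messages_law_distance[OF finite_atLeastAtMost mu p(1)[OF z] p(2)[OF z]
            p(1)[OF flip_cube[OF z]] p(2)[OF flip_cube[OF z]] ac[OF z] \<phi>[OF z] RN[OF z] channels
            d_bound _ A])
           (auto simp: d_def)
      then show ?thesis by (simp add: B_def P_def)
    qed

    have upd: "z(i := s) \<in> cube k" if "z \<in> cube k" "i \<in> {1..k}" "s \<in> {-1, 1}" for z i s
      using that by (auto simp: cube_def PiE_iff extensional_def)
    have RPc: "z \<in> cube k" if "z \<in> set_pmf (Rad_power k \<tau>)" for z
      using that set_Rad_power by auto
    have P_cond_eq: "P_cond i s = mixture (map_pmf (\<lambda>z. z(i := s)) (Rad_power k \<tau>)) P"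
      if "i \<in> {1..k}" "s \<in> {-1, 1}" for i s
      unfolding P_cond_def using that tau by (subst cond_Rad_power) auto
    have Pm: "P z \<in> space (prob_algebra (messages_space \<mu> n))"
      if i: "i \<in> {1..k}" and s: "s \<in> {-1, 1}"
        and z: "z \<in> set_pmf (map_pmf (\<lambda>z. z(i := s)) (Rad_power k \<tau>))" for i s z
    proof -
      obtain z' where "z' \<in> set_pmf (Rad_power k \<tau>)" "z = z'(i := s)" using z by auto
      then show ?thesis using P[OF upd[OF RPc i s]] by blast
    qed
    have P_cond: "P_cond i s \<in> space (prob_algebra (messages_space \<mu> n))" if "i \<in> {1..k}" "s \<in> {-1, 1}" for i s
      unfolding P_cond_eq[OF that] by (rule mixture_in_prob_algebra[OF Pm[OF that]])
    \<comment> \<open>This couples the two conditional laws: both are averages over the same Z, with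
      only coordinate \<open>i\<close> overwritten, so their difference is an average of
      differences.\<close>
    have P_cond_measure: "measure (P_cond i s) A = (\<integral>z. measure (P (z(i := s))) A \<partial>Rad_power k \<tau>)"
      if "i \<in> {1..k}" "s \<in> {-1, 1}" "A \<in> sets (messages_space \<mu> n)" for i s A
      unfolding P_cond_eq[OF that(1,2)] by (rule trans[OF measure_mixture[OF Pm[OF that(1,2)] that(3)]], assumption, simp)
    have int: "integrable (Rad_power k \<tau>) f" for f :: "_ \<Rightarrow> real"
      by (rule integrable_measure_pmf_finite) (rule finite_subset[OF set_Rad_power finite_cube])

    have "(\<Sum>i=1..k. \<bar>measure (P_cond i 1) (A i) - measure (P_cond i (-1)) (A i)\<bar>) \<le> B"
      if A: "\<And>i. i \<in> {1..k} \<Longrightarrow> A i \<in> sets (messages_space \<mu> n)" for A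
    proof -
      have "(\<Sum>i=1..k. \<bar>measure (P_cond i 1) (A i) - measure (P_cond i (-1)) (A i)\<bar>)
          = (\<Sum>i=1..k. \<bar>\<integral>z. measure (P (z(i := 1))) (A i) - measure (P (z(i := -1))) (A i) \<partial>Rad_power k \<tau>\<bar>)"
        using P_cond_measure[OF _ _ A] by (intro sum.cong refl) (simp add: int)
      also have "\<dots> \<le> (\<Sum>i=1..k. \<integral>z. \<bar>measure (P (z(i := 1))) (A i) - measure (P (z(i := -1))) (A i)\<bar> \<partial>Rad_power k \<tau>)"
        by (intro sum_mono integral_abs_bound)
      also have "\<dots> = (\<integral>z. (\<Sum>i=1..k. \<bar>measure (P (z(i := 1))) (A i) - measure (P (z(i := -1))) (A i)\<bar>) \<partial>Rad_power k \<tau>)"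
        by (simp add: int)
      also have "\<dots> \<le> B"
      proof (rule measure_pmf.integral_le_const[OF int], unfold AE_measure_pmf_iff, rule ballI)
        fix z assume "z \<in> set_pmf (Rad_power k \<tau>)"
        then have z: "z \<in> cube k" by (rule RPc)
        \<comment> \<open>One of the two overwritten points is \<open>z\<close> and the other its
          neighbour; which is which only affects the sign inside the absolute value.\<close>
        have "\<bar>measure (P (z(i := 1))) (A i) - measure (P (z(i := -1))) (A i)\<bar>
            = \<bar>measure (P z) (A i) - measure (P (flip i z)) (A i)\<bar>" if i: "i \<in> {1..k}" for i
        proof -
          have "z i \<in> {-1, 1}" using z i by (auto simp: cube_def)
          then have "z(i := 1) = z \<and> z(i := -1) = flip i z \<or> z(i := 1) = flip i z \<and> z(i := -1) = z"
            by (auto simp: flip_def fun_eq_iff)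
          then show ?thesis by (auto simp: abs_minus_commute)
        qed
        then show "(\<Sum>i=1..k. \<bar>measure (P (z(i := 1))) (A i) - measure (P (z(i := -1))) (A i)\<bar>) \<le> B"
          using flip_dist[OF z A] by simp
      qed
      finally show ?thesis .
    qed
    \<comment> \<open>The bound holds for an arbitrary choice of one event per coordinate, so the
      total variation distances can be attained separately in the limit.\<close>
    then have "(\<Sum>i=1..k. SUP A\<in>sets (messages_space \<mu> n). \<bar>measure (P_cond i 1) A - measure (P_cond i (-1)) A\<bar>) \<le> B"
      by (intro sum_SUP_le) auto
    moreover have "tv_dist (P_cond i 1) (P_cond i (-1))
        = (SUP A\<in>sets (messages_space \<mu> n). \<bar>measure (P_cond i 1) A - measure (P_cond i (-1)) A\<bar>)"
      if "i \<in> {1..k}" for i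
      using P_cond[OF that, of 1] by (simp add: tv_dist_def space_prob_algebra)
    ultimately have le: "(\<Sum>i=1..k. tv_dist (P_cond i 1) (P_cond i (-1))) \<le> B"
      by simp
    have "0 \<le> (\<Sum>i=1..k. tv_dist (P_cond i 1) (P_cond i (-1)))"
      by (intro sum_nonneg tv_dist_nonneg[OF P_cond P_cond]) simp_all
    with le have "(\<Sum>i=1..k. tv_dist (P_cond i 1) (P_cond i (-1)))\<^sup>2 \<le> B\<^sup>2"
      by (intro power_mono)
    also have d0: "0 \<le> (\<Sum>t=1..n. d t)"
      by (intro sum_nonneg) (simp add: d_def)
    then have "B\<^sup>2 = real k * (9 / 2 * (\<Sum>t=1..n. d t))"
      by (simp add: B_def)
    finally have "(1 / real k * (\<Sum>i=1..k. tv_dist (P_cond i 1) (P_cond i (-1))))\<^sup>2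
        \<le> (1 / real k)\<^sup>2 * (real k * (9 / 2 * (\<Sum>t=1..n. d t)))"
      unfolding power_mult_distrib by (intro mult_left_mono) auto
    \<comment> \<open>The factor k from Cauchy-Schwarz cancels one of the two factors 1/k.\<close>
    also have "\<dots> = 1 / real k * (9 / 2 * (\<Sum>t=1..n. d t))"
      using k by (simp add: power2_eq_square)
    \<comment> \<open>The argument yields the constant 9/2; it is relaxed to 7 only here.\<close>
    also have "\<dots> \<le> 1 / real k * (7 * (\<Sum>t=1..n. d t))"
      using d0 by (intro mult_left_mono mult_right_mono) auto
    finally have "ennreal ((1 / real k * (\<Sum>i=1..k. tv_dist (P_cond i 1) (P_cond i (-1))))\<^sup>2)
        \<le> ennreal (7 / real k * (\<Sum>t=1..n. d t))"
      by (intro ennreal_leI) simp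
    also have "\<dots> = ennreal (7 / real k) * ennreal (\<Sum>t=1..n. d t)"
      using d0 by (intro ennreal_mult) auto
    also have "ennreal (\<Sum>t=1..n. d t) = (\<Sum>t=1..n. ennreal (d t))"
      by (intro sum_ennreal[symmetric]) (simp add: d_def)
    also have "\<dots> = (\<Sum>t=1..n. ennreal (\<alpha>\<^sup>2) * S t)"
      by (intro sum.cong refl d_eq)
    finally show ?thesis unfolding rhs .
  qed
  then show ?thesis unfolding S_def I_def .
qed

end
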